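(* Let $p$ be an odd prime, let $m$ be a positive integer, let $\mathrm{Tr}$ be the trace function from $\mathbb{F}_{p^m}$ to $\mathbb{F}_p$, and let $D=\{x\in\mathbb{F}_{p^m}^*:\mathrm{Tr}(x^2)=0\}=\{d_1,d_2,\dots,d_n\}$ (with $d_1,\dots,d_n$ distinct). Let $$C_{D,b}=\{(\mathrm{Tr}(ad_1)+b,\mathrm{Tr}(ad_2)+b,\dots,\mathrm{Tr}(ad_n)+b):a\in\mathbb{F}_{p^m},\,b\in\mathbb{F}_p\},$$ and let $A_i$ be the number of codewords of Hamming weight $i$ in $C_{D,b}$. In the lists below, whenever several entries have the same weight $i$, $A_i$ is the sum of the corresponding multiplicities; and $A_i=0$ for all weights $i$ not listed. (A) If $m\geqslant 3$ is odd, the weight distribution of $C_{D,b}$ is given by the following list (weight: multiplicity): - $0$: $1$; - $p^{m-1}-1$: $p-1$; - $(p-1)p^{m-2}$: $p^{m-1}-1$; - $(p-1)p^{m-2}-1$: $(p-1)(p^{m-1}-1)$; - $(p-1)(p^{m-2}-p^{\frac{m-3}{2}})$: $\frac{p-1}{2}(p^{m-1}+p^{\frac{m-1}{2}})$; - $(p-1)p^{m-2}+p^{\frac{m-3}{2}}-1$: $\frac{(p-1)^2}{2}(p^{m-1}+p^{\frac{m-1}{2}})$; - $(p-1)(p^{m-2}+p^{\frac{m-3}{2}})$: $\frac{p-1}{2}(p^{m-1}-p^{\frac{m-1}{2}})$; - $(p-1)p^{m-2}-p^{\frac{m-3}{2}}-1$: $\frac{(p-1)^2}{2}(p^{m-1}-p^{\frac{m-1}{2}})$.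 (B) If $m\geqslant 2$ is even, then, writing $\varepsilon=(-1)^{\frac{m}{2}\left(\frac{p-1}{2}\right)^2}$, the weight distribution of $C_{D,b}$ is given by the following list (weight: multiplicity): - $0$: $1$; - $p^{m-1}-1-\varepsilon(p-1)p^{\frac{m-2}{2}}$: $p-1$; - $(p-1)p^{m-2}$: $p^{m-1}-1-\varepsilon(p-1)p^{\frac{m-2}{2}}$; - $(p-1)(p^{m-2}-\varepsilon p^{\frac{m-2}{2}})-1$: $(p-1)\left(p^{m-1}-1-\varepsilon(p-1)p^{\frac{m-2}{2}}\right)$; - $(p-1)(p^{m-2}-\varepsilon p^{\frac{m-2}{2}})$: $(p-1)(p^{m-1}+\varepsilon p^{\frac{m-2}{2}})$; - $(p-1)p^{m-2}-(p-2)\varepsilon p^{\frac{m-2}{2}}-1$: $(p-1)^2(p^{m-1}+\varepsilon p^{\frac{m-2}{2}})$.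
   Context: The Hamming weight of a vector is its number of nonzero coordinates. The subscript $b$ in $C_{D,b}$ is only part of the name of the code: $b$ ranges over all of $\mathbb{F}_p$ in its definition.
   Formalization: In (B), for m=2 and p≡1 mod 4, D is empty, so C_{D,b} has one codeword and the list fails for the set of codewords; that case is excluded for the set and proved only counting codewords with multiplicity over pairs (a,b). *)

theory Defs
  imports "HOL-Number_Theory.Number_Theory" "HOL-Library.Cardinality"
begin

text \<open>
  The field with \<open>p ^ m\<close> elements is a type of class \<^class>\<open>finite_field\<close> with
  \<open>CARD('a) = p ^ m\<close>. The field with \<open>p\<close> elements is its prime subfield, so the trace,
  \<open>x + x ^ p + \<dots> + x ^ (p ^ (m - 1))\<close>, takes its values in the type itself.
\<close>

definition prime_field :: "'a::finite_field set" where
  "prime_field = range of_nat"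

definition field_trace :: "nat \<Rightarrow> nat \<Rightarrow> 'a::finite_field \<Rightarrow> 'a" where
  "field_trace p m x = (\<Sum>i<m. x ^ (p ^ i))"

definition defining_set :: "nat \<Rightarrow> nat \<Rightarrow> 'a::finite_field set" where
  "defining_set p m = {x. x \<noteq> 0 \<and> field_trace p m (x ^ 2) = 0}"

definition hamming_weight :: "'a::zero list \<Rightarrow> nat" where
  "hamming_weight c = card {j. j < length c \<and> c ! j \<noteq> 0}"

definition codeword :: "nat \<Rightarrow> nat \<Rightarrow> 'a::finite_field list \<Rightarrow> 'a \<Rightarrow> 'a \<Rightarrow> 'a list" where
  "codeword p m ds a b = map (\<lambda>d. field_trace p m (a * d) + b) ds"

definition code :: "nat \<Rightarrow> nat \<Rightarrow> 'a::finite_field list \<Rightarrow> 'a list set" where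
  "code p m ds = {codeword p m ds a b | a b. b \<in> prime_field}"

definition weight_count :: "'a::zero list set \<Rightarrow> nat \<Rightarrow> nat" where
  "weight_count C i = card {c \<in> C. hamming_weight c = i}"

text \<open>
  The same count for the family of codewords indexed by the pairs \<open>(a, b)\<close>. It differs from
  \<^const>\<open>weight_count\<close> only if two pairs give the same codeword; for the enumerations of the
  defining set with \<open>m \<ge> 2\<close> this happens only when that set is empty, that is, when \<open>m = 2\<close>
  and \<open>p mod 4 = 1\<close>.
\<close>

definition family_weight_count :: "nat \<Rightarrow> nat \<Rightarrow> 'a::finite_field list \<Rightarrow> nat \<Rightarrow> nat" where
  "family_weight_count p m ds i =
     card {(a, b). b \<in> prime_field \<and> hamming_weight (codeword p m ds a b) = i}"

text \<open>
  A table lists pairs (weight, multiplicity). Multiplicities of equal weights are added up, and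
  weights that are not listed have multiplicity \<open>0\<close>. Entries are integers because
  one listed weight is \<open>-1\<close>, with multiplicity \<open>0\<close>, when \<open>m = 2\<close> and \<open>p mod 4 = 1\<close>.
\<close>

definition has_weight_distribution :: "(nat \<Rightarrow> nat) \<Rightarrow> (int \<times> int) list \<Rightarrow> bool" where
  "has_weight_distribution A T \<longleftrightarrow>
     (\<forall>i. int (A i) = (\<Sum>(w, k) \<leftarrow> T. if w = int i then k else 0))"

text \<open>
  In the tables all uses of \<open>div\<close> are exact: \<open>p\<close> is odd, and \<open>m\<close> is odd with \<open>m \<ge> 3\<close> in the
  first table and even with \<open>m \<ge> 2\<close> in the second.
\<close>

definition odd_table :: "int \<Rightarrow> nat \<Rightarrow> (int \<times> int) list" where
  "odd_table p m =
    [(0, 1),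
     (p ^ (m - 1) - 1, p - 1),
     ((p - 1) * p ^ (m - 2), p ^ (m - 1) - 1),
     ((p - 1) * p ^ (m - 2) - 1, (p - 1) * (p ^ (m - 1) - 1)),
     ((p - 1) * (p ^ (m - 2) - p ^ ((m - 3) div 2)),
        (p - 1) div 2 * (p ^ (m - 1) + p ^ ((m - 1) div 2))),
     ((p - 1) * p ^ (m - 2) + p ^ ((m - 3) div 2) - 1,
        (p - 1) ^ 2 div 2 * (p ^ (m - 1) + p ^ ((m - 1) div 2))),
     ((p - 1) * (p ^ (m - 2) + p ^ ((m - 3) div 2)),
        (p - 1) div 2 * (p ^ (m - 1) - p ^ ((m - 1) div 2))),
     ((p - 1) * p ^ (m - 2) - p ^ ((m - 3) div 2) - 1,
        (p - 1) ^ 2 div 2 * (p ^ (m - 1) - p ^ ((m - 1) div 2)))]"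

definition even_sign :: "nat \<Rightarrow> nat \<Rightarrow> int" where
  "even_sign p m = (-1) ^ (m div 2 * ((p - 1) div 2) ^ 2)"

definition even_table :: "int \<Rightarrow> nat \<Rightarrow> int \<Rightarrow> (int \<times> int) list" where
  "even_table p m \<epsilon> =
    [(0, 1),
     (p ^ (m - 1) - 1 - \<epsilon> * (p - 1) * p ^ ((m - 2) div 2), p - 1),
     ((p - 1) * p ^ (m - 2), p ^ (m - 1) - 1 - \<epsilon> * (p - 1) * p ^ ((m - 2) div 2)),
     ((p - 1) * (p ^ (m - 2) - \<epsilon> * p ^ ((m - 2) div 2)) - 1,
        (p - 1) * (p ^ (m - 1) - 1 - \<epsilon> * (p - 1) * p ^ ((m - 2) div 2))),
     ((p - 1) * (p ^ (m - 2) - \<epsilon> * p ^ ((m - 2) div 2)),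
        (p - 1) * (p ^ (m - 1) + \<epsilon> * p ^ ((m - 2) div 2))),
     ((p - 1) * p ^ (m - 2) - (p - 2) * \<epsilon> * p ^ ((m - 2) div 2) - 1,
        (p - 1) ^ 2 * (p ^ (m - 1) + \<epsilon> * p ^ ((m - 2) div 2)))]"

end

theory Submission
  imports Defs "HOL-Computational_Algebra.Polynomial"
begin

text \<open>
  Write \<open>Q x = Tr (x ^ 2)\<close> and \<open>N t\<close> for the number of \<open>x\<close> with \<open>Q x = t\<close>. For \<open>a \<noteq> 0\<close>, counting the
  pairs \<open>(x, l)\<close> with \<open>l\<close> in the prime field and \<open>Q x = l\<^sup>2 Q a\<close>, once directly and once after the
  substitution \<open>x = y + l a\<close>, which turns the equation into \<open>Q y + 2 l Tr (a y) = 0\<close>, expresses the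
  number of isotropic vectors in the hyperplane \<open>Tr (a x) = 0\<close> through \<open>N 0\<close> and \<open>N (Q a)\<close>; all
  parallel hyperplanes \<open>Tr (a x) = c \<noteq> 0\<close> contain equally many isotropic vectors by scaling.
  So every weight is determined by \<open>N\<close>, and no character sums are needed.

  If \<open>c\<close> is a nonsquare of the field, then \<open>x\<^sup>2\<close> and \<open>c x\<^sup>2\<close> together cover every element
  twice, so that the counts for \<open>Tr (x ^ 2)\<close> and \<open>Tr (c x ^ 2)\<close> add up to \<open>2 p ^ (m - 1)\<close>.
  For odd \<open>m\<close> one can take \<open>c\<close> in the prime field, which gives \<open>N 0 = p ^ (m - 1)\<close>, and the deviation
  of \<open>N t\<close> from the mean follows up to sign from its second moment.
  For even \<open>m = 2 k\<close>, take \<open>c \<noteq> 0\<close> with \<open>c ^ (p ^ k) = - c\<close>. The form \<open>Tr (c x ^ 2)\<close> vanishes on the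
  subfield with \<open>p ^ k\<close> elements, a maximal isotropic subspace, so its zeros can be
  counted; whether \<open>c\<close> is a square decides the sign \<open>\<epsilon>\<close>.
\<close>

section \<open>The prime field and the trace\<close>

text \<open>The inner binomial coefficients \<open>p choose k\<close> are divisible by the
  characteristic; higher powers follow by iterating.\<close>

lemma finite_field_freshman_dream:
  fixes x y :: "'a::finite_field"
  shows "(x + y) ^ (CHAR('a) ^ i) = x ^ (CHAR('a) ^ i) + y ^ (CHAR('a) ^ i)"
proof (induction i)
  case (Suc i)
  let ?p = "CHAR('a)"
  have p: "prime ?p"
    by (rule CHAR_prime)
  have dream: "(u + v) ^ ?p = u ^ ?p + v ^ ?p" for u v :: 'a
  proof -
    have "(u + v) ^ ?p = (\<Sum>k\<le>?p. of_nat (?p choose k) * u ^ k * v ^ (?p - k))"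
      by (rule binomial_ring)
    also have "\<dots> = (\<Sum>k\<in>{0, ?p}. of_nat (?p choose k) * u ^ k * v ^ (?p - k))"
    proof (rule sum.mono_neutral_right)
      show "\<forall>k\<in>{..?p} - {0, ?p}. of_nat (?p choose k) * u ^ k * v ^ (?p - k) = 0"
      proof
        fix k assume "k \<in> {..?p} - {0, ?p}"
        then have "?p dvd (?p choose k)"
          using p by (intro dvd_choose_prime) auto
        then have "of_nat (?p choose k) = (0::'a)"
          using of_nat_eq_0_iff_char_dvd by blast
        then show "of_nat (?p choose k) * u ^ k * v ^ (?p - k) = 0"
          by simp
      qed
    qed auto
    also have "\<dots> = u ^ ?p + v ^ ?p"
      by simp
    finally show ?thesis .
  qed
  show ?case
    by (simp add: power_mult Suc dream mult.commute[of ?p])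
qed simp

text \<open>As \<open>n > 0\<close>, the constant term leaves the leading coefficient of
  \<open>X ^ n - c\<close> intact, so this polynomial is nonzero.\<close>

lemma card_roots_power_le:
  fixes c :: "'a::{comm_ring_1,ring_no_zero_divisors}"
  assumes "n > 0"
  shows "card {x::'a. x ^ n = c} \<le> n"
proof -
  let ?f = "Polynomial.monom 1 n - Polynomial.monom c 0 :: 'a poly"
  have "Polynomial.coeff ?f n = 1"
    using assms by (cases n) auto
  then have "?f \<noteq> 0"
    by force
  moreover have "Polynomial.degree ?f \<le> n"
    by (rule degree_diff_le) (use degree_monom_le[of c 0] in \<open>auto simp: degree_monom_le\<close>)
  moreover have "{x. x ^ n = c} = {x. poly ?f x = 0}"
    by (auto simp: poly_monom)
  ultimately show ?thesis
    using card_poly_roots_bound[of ?f] by auto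
qed

lemma card_vimage_eq_sum:
  fixes f :: "'a::finite \<Rightarrow> 'b"
  assumes "finite B"
  shows "card {x. P x \<and> f x \<in> B} = (\<Sum>b\<in>B. card {x. P x \<and> f x = b})"
proof -
  have "{x. P x \<and> f x \<in> B} = (\<Union>b\<in>B. {x. P x \<and> f x = b})"
    by auto
  then show ?thesis
    using assms by (auto intro!: card_UN_disjoint)
qed

section \<open>The field of order \<open>p ^ m\<close> and its prime subfield\<close>

locale field_extension =
  fixes p m :: nat and type :: "'a::finite_field itself"
  assumes prime: "prime p" and odd_p: "odd p" and m_pos: "m > 0"
    and card_field: "CARD('a) = p ^ m"
begin

abbreviation Tr :: "'a \<Rightarrow> 'a" where
  "Tr \<equiv> field_trace p m"

abbreviation P :: "'a set" where
  "P \<equiv> prime_field"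

lemma p_ge_3: "p \<ge> 3"
  using prime odd_p prime_ge_2_nat[of p] by (cases "p = 2") auto

lemma CHAR_eq: "CHAR('a) = p"
proof -
  have "prime CHAR('a)"
    by (rule CHAR_prime)
  moreover have "CHAR('a) dvd p ^ m"
    using CHAR_dvd_CARD[where 'a = 'a] card_field by simp
  ultimately show ?thesis
    using prime prime_dvd_power primes_dvd_imp_eq by blast
qed

lemma power_card_minus_1:
  fixes x :: 'a
  assumes "x \<noteq> 0"
  shows "x ^ (p ^ m - 1) = 1"
proof -
  have "x ^ (p ^ m) = x"
    using finite_field_power_card_eq_same[of x] card_field by simp
  moreover have "x ^ (p ^ m) = x * x ^ (p ^ m - 1)"
    using prime by (metis One_nat_def Suc_pred power_Suc prime_gt_0_nat zero_less_power)
  ultimately show ?thesis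
    using assms by simp
qed

lemma frobenius_add: "(x + y :: 'a) ^ (p ^ i) = x ^ (p ^ i) + y ^ (p ^ i)"
  using finite_field_freshman_dream[of x y i] by (simp add: CHAR_eq)

lemma frobenius_uminus: "(- x :: 'a) ^ (p ^ i) = - (x ^ (p ^ i))"
  using odd_p by simp

lemma frobenius_diff: "(x - y :: 'a) ^ (p ^ i) = x ^ (p ^ i) - y ^ (p ^ i)"
  using frobenius_add[of x "- y" i] odd_p by simp

lemma of_nat_frobenius: "(of_nat n :: 'a) ^ p = of_nat n"
proof (induction n)
  case 0
  show ?case
    using prime by (simp add: prime_gt_0_nat)
next
  case (Suc n)
  then show ?case
    using frobenius_add[of 1 "of_nat n" 1] by simp
qed

lemma card_P: "card P = p"
proof -
  have "P = (of_nat ` {..<p} :: 'a set)"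
  proof
    show "P \<subseteq> (of_nat ` {..<p} :: 'a set)"
    proof
      fix x :: 'a
      assume "x \<in> P"
      then obtain n where "x = of_nat n"
        by (auto simp: prime_field_def)
      then have "x = of_nat (n mod p)"
        by (simp add: of_nat_eq_iff_cong_CHAR CHAR_eq cong_def)
      moreover have "n mod p < p"
        using prime by (simp add: prime_gt_0_nat)
      ultimately show "x \<in> of_nat ` {..<p}"
        by blast
    qed
  qed (auto simp: prime_field_def)
  moreover have "inj_on (of_nat :: nat \<Rightarrow> 'a) {..<p}"
    by (auto simp: inj_on_def of_nat_eq_iff_cong_CHAR CHAR_eq cong_def)
  ultimately show ?thesis
    by (metis card_image card_lessThan)
qed

text \<open>By Fermat, \<open>P\<close> consists of roots of \<open>x ^ p = x\<close>; there are at
  most \<open>p\<close> roots and \<open>P\<close> has \<open>p\<close> elements. Closure of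
  \<open>P\<close> under the field operations then reduces to the Frobenius rules.\<close>

lemma P_iff: "x \<in> P \<longleftrightarrow> x ^ p = x"
proof -
  have "P \<subseteq> {x. x ^ p = x}"
    by (auto simp: prime_field_def of_nat_frobenius)
  moreover have "card {x::'a. x ^ p = x} \<le> card P"
  proof -
    let ?S = "{x::'a. x ^ (p - 1) = 1}"
    have "{x::'a. x ^ p = x} \<subseteq> insert 0 ?S"
      using prime by (auto simp: power_eq_if[of _ p] prime_gt_0_nat)
    then have "card {x::'a. x ^ p = x} \<le> card (insert 0 ?S)"
      by (intro card_mono) auto
    also have "\<dots> \<le> Suc (card ?S)"
      by (simp add: card_insert_if)
    also have "card ?S \<le> p - 1"
      using p_ge_3 by (intro card_roots_power_le) auto
    finally show ?thesis
      using p_ge_3 card_P by simp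
  qed
  ultimately have "P = {x. x ^ p = x}"
    by (intro card_seteq) auto
  then show ?thesis
    by blast
qed

lemma P_frobenius: "x \<in> P \<Longrightarrow> x ^ (p ^ i) = x"
  by (induction i) (simp_all add: P_iff power_mult)

lemma P_power_minus_1: "x \<in> P \<Longrightarrow> x \<noteq> 0 \<Longrightarrow> x ^ (p - 1) = 1"
  using p_ge_3 by (simp add: P_iff power_eq_if[of _ p])

lemma P_0 [simp]: "0 \<in> P" and P_1 [simp]: "1 \<in> P"
  by (auto simp: P_iff)
    (use prime in \<open>auto simp: prime_gt_0_nat\<close>)

lemma P_add [intro]: "x \<in> P \<Longrightarrow> y \<in> P \<Longrightarrow> x + y \<in> P"
  using frobenius_add[of x y 1] by (simp add: P_iff)

lemma P_uminus [intro]: "x \<in> P \<Longrightarrow> - x \<in> P"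
  using frobenius_uminus[of x 1] by (simp add: P_iff)

lemma P_diff [intro]: "x \<in> P \<Longrightarrow> y \<in> P \<Longrightarrow> x - y \<in> P"
  using frobenius_diff[of x y 1] by (simp add: P_iff)

lemma P_mult [intro]: "x \<in> P \<Longrightarrow> y \<in> P \<Longrightarrow> x * y \<in> P"
  by (simp add: P_iff power_mult_distrib)

lemma P_divide [intro]: "x \<in> P \<Longrightarrow> y \<in> P \<Longrightarrow> x / y \<in> P"
  by (simp add: P_iff power_divide)

lemma P_power [intro]: "x \<in> P \<Longrightarrow> x ^ n \<in> P"
  by (induction n) auto

lemma two_neq_0: "(2::'a) \<noteq> 0"
proof
  assume "(2::'a) = 0"
  then have "of_nat 2 = (0::'a)"
    by simp
  then have "p dvd 2"
    using of_nat_eq_0_iff_char_dvd CHAR_eq by metis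
  then show False
    using p_ge_3 by (auto dest: dvd_imp_le)
qed

lemma two_in_P: "2 \<in> P"
  using P_add[of 1 1] by simp

section \<open>The trace as a linear form\<close>

lemma Tr_add: "Tr (x + y) = Tr x + Tr y"
  by (simp add: field_trace_def frobenius_add sum.distrib)

lemma Tr_uminus: "Tr (- x) = - Tr x"
  by (simp add: field_trace_def frobenius_uminus sum_negf)

lemma Tr_diff: "Tr (x - y) = Tr x - Tr y"
  using Tr_add[of x "- y"] by (simp add: Tr_uminus)

lemma Tr_0 [simp]: "Tr 0 = 0"
  using Tr_add[of 0 0] by (metis add_cancel_right_right)

lemma Tr_scale: "c \<in> P \<Longrightarrow> Tr (c * x) = c * Tr x"
  by (simp add: field_trace_def power_mult_distrib P_frobenius sum_distrib_left)

text \<open>Taking \<open>p\<close>-th powers shifts the summation index by one, and the new top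
  term \<open>x ^ (p ^ m)\<close> equals the lost bottom term \<open>x\<close>.\<close>

lemma Tr_in_P [simp, intro]: "Tr x \<in> P"
proof -
  have sum_frob: "(\<Sum>i\<in>A. f i :: 'a) ^ p = (\<Sum>i\<in>A. f i ^ p)" if "finite A" for A :: "nat set" and f
    using that
    by (induction A) (use frobenius_add[of _ _ 1] prime in \<open>auto simp: prime_gt_0_nat\<close>)
  have "(Tr x) ^ p = (\<Sum>i<m. x ^ (p ^ Suc i))"
    by (simp add: field_trace_def sum_frob power_mult[symmetric] mult.commute)
  also have "\<dots> = (\<Sum>i<Suc m. x ^ (p ^ i)) - x"
    by (simp only: sum.lessThan_Suc_shift) simp
  also have "\<dots> = Tr x"
    using finite_field_power_card_eq_same[of x] card_field by (simp add: field_trace_def)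
  finally show ?thesis
    by (simp add: P_iff)
qed

text \<open>A nonzero polynomial of degree at most \<open>p ^ (k - 1)\<close> cannot vanish on a
  larger set. The case \<open>k = m\<close> concerns the trace itself, the case
  \<open>m = 2 * k\<close> the trace of the subfield of half the degree.\<close>

lemma exists_linearized_nonroot:
  assumes "k > 0" and "card W > p ^ (k - 1)"
  shows "\<exists>w\<in>W. (\<Sum>i<k. w ^ (p ^ i) :: 'a) \<noteq> 0"
proof (rule ccontr)
  assume "\<not> ?thesis"
  then have zero: "W \<subseteq> {w. (\<Sum>i<k. w ^ (p ^ i)) = 0}"
    by auto
  let ?f = "\<Sum>i<k. Polynomial.monom (1::'a) (p ^ i)"
  have "poly ?f w = (\<Sum>i<k. w ^ (p ^ i))" for w
    by (simp add: poly_sum poly_monom)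
  then have W: "W \<subseteq> {w. poly ?f w = 0}"
    using zero by simp
  have "Polynomial.coeff ?f (p ^ (k - 1)) = (\<Sum>i<k. if i = k - 1 then 1 else 0)"
    using p_ge_3 unfolding coeff_sum coeff_monom
    by (intro sum.cong if_cong) (auto simp: power_inject_exp)
  also have "\<dots> = 1"
    using assms(1) by simp
  finally have "?f \<noteq> 0"
    by force
  then have "card {w. poly ?f w = 0} \<le> Polynomial.degree ?f"
    by (rule card_poly_roots_bound)
  also have "\<dots> \<le> p ^ (k - 1)"
  proof (rule degree_sum_le)
    fix i assume "i \<in> {..<k}"
    then have "p ^ i \<le> p ^ (k - 1)"
      using p_ge_3 by (intro power_increasing) auto
    then show "Polynomial.degree (Polynomial.monom (1::'a) (p ^ i)) \<le> p ^ (k - 1)"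
      using degree_monom_le order_trans by blast
  qed simp
  finally show False
    using assms(2) card_mono[OF _ W] by simp
qed

lemma Tr_nondegenerate:
  assumes "a \<noteq> 0"
  shows "\<exists>x. Tr (a * x) \<noteq> 0"
proof -
  have "\<exists>w\<in>UNIV. Tr w \<noteq> 0"
    using exists_linearized_nonroot[of m UNIV] m_pos p_ge_3 card_field
    by (auto simp: field_trace_def intro!: power_strict_increasing)
  then obtain w where "Tr w \<noteq> 0"
    by blast
  then have "Tr (a * (w / a)) \<noteq> 0"
    using assms by simp
  then show ?thesis
    by blast
qed

text \<open>The fibres of a nonzero linear form on a \<open>P\<close>-subspace are translates of its
  kernel. \<open>W\<close> is general because both the whole field and a subfield occur.\<close>

lemma card_Tr_mult_fibre_subspace:
  assumes add: "\<And>x y. x \<in> W \<Longrightarrow> y \<in> W \<Longrightarrow> x + y \<in> W"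
    and scale: "\<And>c x. c \<in> P \<Longrightarrow> x \<in> W \<Longrightarrow> c * x \<in> W"
    and w: "w \<in> W" "Tr (a * w) \<noteq> 0" and t: "t \<in> P"
  shows "p * card {x \<in> W. Tr (a * x) = t} = card W"
proof -
  \<comment> \<open>\<open>d s\<close> is the multiple of \<open>w\<close> at which the form takes
    the value \<open>s\<close>; translation by it carries the kernel onto the fibre over
    \<open>s\<close>.\<close>
  define d where "d s = (s / Tr (a * w)) * w" for s
  have d: "Tr (a * d s) = s" "d s \<in> W" if "s \<in> P" for s
  proof -
    have "Tr (a * d s) = Tr ((s / Tr (a * w)) * (a * w))"
      by (simp add: d_def mult_ac)
    also have "\<dots> = s"
      using that w by (subst Tr_scale) auto
    finally show "Tr (a * d s) = s" .
    show "d s \<in> W"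
      unfolding d_def using that w by (intro scale P_divide Tr_in_P)
  qed
  have diff: "x - y \<in> W" if "x \<in> W" "y \<in> W" for x y
    using add[OF that(1) scale[OF P_uminus[OF P_1] that(2)]] by simp
  have fib: "card {x \<in> W. Tr (a * x) = s} = card {x \<in> W. Tr (a * x) = 0}" if "s \<in> P" for s
    by (rule bij_betw_same_card[of "\<lambda>x. x - d s"],
        rule bij_betw_byWitness[where f' = "\<lambda>x. x + d s"])
      (auto simp: right_diff_distrib distrib_left Tr_diff Tr_add d that add diff)
  have "card W = card {x. x \<in> W \<and> Tr (a * x) \<in> P}"
    by simp
  also have "\<dots> = (\<Sum>s\<in>P. card {x \<in> W. Tr (a * x) = s})"
    by (rule card_vimage_eq_sum) simp
  also have "\<dots> = (\<Sum>s\<in>P. card {x \<in> W. Tr (a * x) = 0})"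
    by (intro sum.cong refl) (simp only: fib simp_thms)
  also have "\<dots> = p * card {x \<in> W. Tr (a * x) = t}"
    by (simp only: fib[OF t] sum_constant card_P of_nat_id)
  finally show ?thesis ..
qed

lemma card_Tr_mult_fibre:
  assumes "a \<noteq> 0" and "t \<in> P"
  shows "card {x. Tr (a * x) = t} = p ^ (m - 1)"
proof -
  obtain w where "Tr (a * w) \<noteq> 0"
    using Tr_nondegenerate[OF assms(1)] by blast
  then have "p * card {x. Tr (a * x) = t} = p ^ m"
    using card_Tr_mult_fibre_subspace[of UNIV w a t] assms(2) card_field by simp
  also have "\<dots> = p * p ^ (m - 1)"
    using m_pos by (cases m) auto
  finally show ?thesis
    using p_ge_3 by simp
qed

end

section \<open>Weights in terms of the quadratic form \<open>Tr (x ^ 2)\<close>\<close>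

lemma sum_card_swap:
  assumes "finite A" and "finite B"
  shows "(\<Sum>a\<in>A. card {b \<in> B. R a b}) = (\<Sum>b\<in>B. card {a \<in> A. R a b})"
  using assms by (rule sum_multicount_gen) simp

context field_extension
begin

text \<open>This is \<open>N t\<close> from the overview. The zero vector, absent from
  \<open>defining_set\<close>, is counted here for \<open>t = 0\<close>.\<close>

definition qcount :: "'a \<Rightarrow> nat" where
  "qcount t = card {x. Tr (x ^ 2) = t}"

definition isotropic_count :: "'a \<Rightarrow> 'a \<Rightarrow> nat" where
  "isotropic_count a c = card {x. Tr (a * x) = c \<and> Tr (x ^ 2) = 0}"

section \<open>Level sets of the form and their hyperplane sections\<close>

lemma Tr_square_scale: "c \<in> P \<Longrightarrow> Tr ((c * x) ^ 2) = c ^ 2 * Tr (x ^ 2)"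
  by (simp add: power_mult_distrib Tr_scale P_power)

lemma Tr_square_add: "Tr ((x + y) ^ 2) = Tr (x ^ 2) + 2 * Tr (x * y) + Tr (y ^ 2)"
proof -
  have "(x + y) ^ 2 = x ^ 2 + 2 * (x * y) + y ^ 2"
    by (simp add: power2_sum mult_ac)
  then show ?thesis
    by (simp only: Tr_add Tr_scale[OF two_in_P])
qed

text \<open>Multiplication by \<open>r\<close> maps one level set onto the other. The assumption is
  on \<open>r ^ 2\<close> because in even degree square roots of elements of \<open>P\<close> may
  lie outside \<open>P\<close>.\<close>

lemma qcount_scale:
  assumes "r ^ 2 \<in> P" and "r \<noteq> 0"
  shows "qcount (r ^ 2 * t) = qcount t"
proof -
  have scale: "Tr ((r * x) ^ 2) = r ^ 2 * Tr (x ^ 2)" for x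
    using assms(1) by (simp add: power_mult_distrib Tr_scale)
  have "{x. Tr (x ^ 2) = r ^ 2 * t} = (*) r ` {x. Tr (x ^ 2) = t}" (is "?L = (*) r ` ?R")
  proof
    show "?L \<subseteq> (*) r ` ?R"
    proof
      fix x assume x: "x \<in> ?L"
      have "x = r * (x / r)"
        using assms by simp
      moreover from this have "x / r \<in> ?R"
        using x assms scale[of "x / r"] by simp
      ultimately show "x \<in> (*) r ` ?R"
        by blast
    qed
  qed (use assms in \<open>auto simp: scale\<close>)
  then show ?thesis
    unfolding qcount_def using assms by (simp add: card_image inj_on_def)
qed

lemma qcount_square:
  assumes "r ^ 2 \<in> P" and "r \<noteq> 0"
  shows "qcount (r ^ 2) = qcount 1"
  using qcount_scale[OF assms, of 1] by simp

lemma sum_qcount: "(\<Sum>t\<in>P. g t * int (qcount t)) = (\<Sum>x\<in>UNIV. g (Tr (x ^ 2)))"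
proof -
  have "(\<Sum>t\<in>P. g t * int (qcount t)) = (\<Sum>t\<in>P. \<Sum>x\<in>{x. Tr (x ^ 2) = t}. g (Tr (x ^ 2)))"
    by (simp add: qcount_def mult.commute)
  also have "\<dots> = (\<Sum>x\<in>UNIV. g (Tr (x ^ 2)))"
    using sum.group[of UNIV P "\<lambda>x. Tr (x ^ 2)" "\<lambda>x. g (Tr (x ^ 2))"] by auto
  finally show ?thesis .
qed

lemma sum_qcount_eq: "(\<Sum>t\<in>P. int (qcount t)) = int p ^ m"
  using sum_qcount[of "\<lambda>_. 1"] card_field by simp

text \<open>In the direct count of pairs \<open>(x, l)\<close>, \<open>l = 0\<close> contributes
  \<open>N 0\<close> and every other \<open>l\<close> contributes \<open>N (Q a)\<close>. The term
  \<open>p ^ m\<close> stands on the left to avoid natural subtraction.\<close>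

lemma isotropic_count_0:
  assumes "a \<noteq> 0"
  shows "p * isotropic_count a 0 + p ^ m = qcount 0 + (p - 1) * qcount (Tr (a ^ 2)) + p ^ (m - 1)"
proof -
  let ?A = "Tr (a ^ 2)"
  have "(\<Sum>l\<in>P. card {x. Tr (x ^ 2) = l ^ 2 * ?A}) =
      (\<Sum>l\<in>P. card {y \<in> UNIV. Tr (y ^ 2) + 2 * l * Tr (a * y) = 0})"
  proof (rule sum.cong[OF refl])
    fix l assume l: "l \<in> P"
    have *: "Tr ((y + l * a) ^ 2) = Tr (y ^ 2) + 2 * l * Tr (a * y) + l ^ 2 * ?A" for y
    proof -
      have "Tr (y * (l * a)) = l * Tr (a * y)"
        using Tr_scale[OF l, of "a * y"] by (simp add: mult_ac)
      then show ?thesis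
        by (simp add: Tr_square_add Tr_square_scale[OF l])
    qed
    have "{x. Tr (x ^ 2) = l ^ 2 * ?A} =
        (\<lambda>y. y + l * a) ` {y \<in> UNIV. Tr (y ^ 2) + 2 * l * Tr (a * y) = 0}" (is "?L = _ ` ?R")
    proof
      show "?L \<subseteq> (\<lambda>y. y + l * a) ` ?R"
      proof
        fix x assume "x \<in> ?L"
        then have "x - l * a \<in> ?R"
          using *[of "x - l * a"] by simp
        then show "x \<in> (\<lambda>y. y + l * a) ` ?R"
          by (rule rev_image_eqI) simp
      qed
    qed (auto simp: *)
    then show "card ?L = card ?R"
      by (simp add: card_image)
  qed
  also have "\<dots> = (\<Sum>y\<in>UNIV. card {l \<in> P. Tr (y ^ 2) + 2 * l * Tr (a * y) = 0})"
    by (rule sum_card_swap) auto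
  \<comment> \<open>For fixed \<open>y\<close> the equation is linear in \<open>l\<close> with slope
    \<open>2 * Tr (a * y)\<close>: a nonzero slope gives one solution in \<open>P\<close>, slope
    zero gives all of \<open>P\<close> or nothing.\<close>
  also have "\<dots> = (\<Sum>y\<in>UNIV. if Tr (a * y) = 0 then if Tr (y ^ 2) = 0 then p else 0 else 1)"
  proof (rule sum.cong[OF refl])
    fix y
    have "{l \<in> P. Tr (y ^ 2) + 2 * l * Tr (a * y) = 0} = {- Tr (y ^ 2) / (2 * Tr (a * y))}"
      if "Tr (a * y) \<noteq> 0"
    proof -
      have "Tr (y ^ 2) + 2 * l * Tr (a * y) = 0 \<longleftrightarrow> l = - Tr (y ^ 2) / (2 * Tr (a * y))" for l
        using that two_neq_0
        by (auto simp: divide_simps eq_neg_iff_add_eq_0 algebra_simps)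
      moreover have "- Tr (y ^ 2) / (2 * Tr (a * y)) \<in> P"
        by (intro P_divide P_uminus P_mult two_in_P Tr_in_P)
      ultimately show ?thesis
        by auto
    qed
    then show "card {l \<in> P. Tr (y ^ 2) + 2 * l * Tr (a * y) = 0} =
        (if Tr (a * y) = 0 then if Tr (y ^ 2) = 0 then p else 0 else 1)"
      by (cases "Tr (a * y) = 0") (simp_all add: card_P)
  qed
  also have "\<dots> = (\<Sum>y\<in>{y. Tr (a * y) = 0}. if Tr (y ^ 2) = 0 then p else 0)
      + card {y. Tr (a * y) \<noteq> 0}"
    by (subst sum.If_cases) (auto simp: Collect_neg_eq)
  also have "(\<Sum>y\<in>{y. Tr (a * y) = 0}. if Tr (y ^ 2) = 0 then p else 0) = p * isotropic_count a 0"
    by (subst sum.If_cases) (auto simp: isotropic_count_def Int_def)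
  also have "card {y. Tr (a * y) \<noteq> 0} = p ^ m - p ^ (m - 1)"
    using card_Tr_mult_fibre[OF assms P_0] card_field
    by (simp add: Collect_neg_eq Compl_eq_Diff_UNIV card_Diff_subset)
  finally have "(\<Sum>l\<in>P. qcount (l ^ 2 * ?A)) = p * isotropic_count a 0 + (p ^ m - p ^ (m - 1))"
    by (simp add: qcount_def)
  moreover have "(\<Sum>l\<in>P. qcount (l ^ 2 * ?A)) = qcount 0 + (\<Sum>l\<in>P - {0}. qcount ?A)"
    by (subst sum.remove[of _ 0]) (auto simp: qcount_scale P_power)
  moreover have "p ^ (m - 1) \<le> p ^ m"
    using p_ge_3 by (intro power_increasing) auto
  ultimately show ?thesis
    by (simp add: card_P)
qed

text \<open>Scaling by nonzero elements of \<open>P\<close> preserves isotropy and permutes the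
  hyperplanes \<open>Tr (a * x) = d\<close> with \<open>d\<close> nonzero in
  \<open>P\<close>.\<close>

lemma isotropic_count_nonzero:
  assumes "c \<in> P" and "c \<noteq> 0"
  shows "isotropic_count a 0 + (p - 1) * isotropic_count a c = qcount 0"
proof -
  have same: "isotropic_count a d = isotropic_count a c" if "d \<in> P" "d \<noteq> 0" for d
  proof -
    have scale: "Tr (a * (r * x)) = r * Tr (a * x)" if "r \<in> P" for r x
      using Tr_scale[OF that, of "a * x"] by (simp add: mult_ac)
    define r where "r = c / d"
    have r: "r \<in> P" "r \<noteq> 0" "c = r * d"
      using assms that by (auto simp: r_def)
    have "{x. Tr (a * x) = c \<and> Tr (x ^ 2) = 0} = (*) r ` {x. Tr (a * x) = d \<and> Tr (x ^ 2) = 0}"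
      (is "?L = (*) r ` ?R")
    proof
      show "?L \<subseteq> (*) r ` ?R"
      proof
        fix x assume x: "x \<in> ?L"
        have "x = r * (x / r)"
          using r by simp
        moreover from this have "x / r \<in> ?R"
          using x r scale[of r "x / r"] Tr_square_scale[of r "x / r"] by simp
        ultimately show "x \<in> (*) r ` ?R"
          by blast
      qed
    qed (use r in \<open>auto simp: scale Tr_square_scale\<close>)
    then show ?thesis
      unfolding isotropic_count_def using r by (simp add: card_image inj_on_def)
  qed
  have "qcount 0 = card {x. Tr (x ^ 2) = 0 \<and> Tr (a * x) \<in> P}"
    by (simp add: qcount_def)
  also have "\<dots> = (\<Sum>d\<in>P. card {x. Tr (x ^ 2) = 0 \<and> Tr (a * x) = d})"
    by (rule card_vimage_eq_sum) simp
  also have "\<dots> = (\<Sum>d\<in>P. isotropic_count a d)"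
    by (simp add: isotropic_count_def conj_commute)
  also have "\<dots> = isotropic_count a 0 + (\<Sum>d\<in>P - {0}. isotropic_count a c)"
    by (subst sum.remove[of _ 0]) (auto simp: same)
  finally show ?thesis
    by (simp add: card_P)
qed

section \<open>Weights of codewords and their multiplicities\<close>

lemma hamming_weight_codeword:
  assumes "distinct ds" and "set ds = defining_set p m"
  shows "hamming_weight (codeword p m ds a b) =
    card {x. x \<noteq> 0 \<and> Tr (x ^ 2) = 0 \<and> Tr (a * x) + b \<noteq> (0::'a)}"
proof -
  let ?J = "{j. j < length ds \<and> Tr (a * ds ! j) + b \<noteq> 0}"
  have "hamming_weight (codeword p m ds a b) = card ?J"
    unfolding hamming_weight_def codeword_def
    by (intro arg_cong[of _ _ card]) auto
  also have "\<dots> = card ((!) ds ` ?J)"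
    using assms(1) by (intro card_image[symmetric] inj_onI) (auto simp: nth_eq_iff_index_eq)
  also have "(!) ds ` ?J = {x \<in> set ds. Tr (a * x) + b \<noteq> 0}"
    by (auto simp: in_set_conv_nth)
  finally show ?thesis
    by (simp add: assms(2) defining_set_def conj_assoc)
qed

lemma qcount_0_pos: "qcount 0 > 0"
proof -
  have "0 \<in> {x. Tr (x ^ 2) = 0}"
    by simp
  then show ?thesis
    unfolding qcount_def card_gt_0_iff by (intro conjI finite) blast
qed

text \<open>Here \<open>v\<close> is the number of isotropic vectors on each hyperplane
  \<open>Tr (a * x) = c\<close> with \<open>c\<close> nonzero in \<open>P\<close>. For
  \<open>b = 0\<close> the support is made up of \<open>p - 1\<close> such sections; for other
  \<open>b\<close> one section is removed from the nonzero isotropic vectors.\<close>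

lemma hamming_weight_codeword_eq:
  assumes ds: "distinct ds" "set ds = defining_set p m"
    and a: "a \<noteq> 0" and b: "b \<in> P"
    and v: "int p * v = int (qcount 0) - int (qcount (Tr (a ^ 2))) + int p ^ (m - 1)"
  shows "int (hamming_weight (codeword p m ds a b)) =
    (if b = 0 then (int p - 1) * v else int (qcount 0) - 1 - v)"
proof -
  have le: "isotropic_count a c \<le> qcount 0" for c
    unfolding isotropic_count_def qcount_def by (rule card_mono) auto
  have iso0: "int p * int (isotropic_count a 0) + int p ^ m =
      int (qcount 0) + (int p - 1) * int (qcount (Tr (a ^ 2))) + int p ^ (m - 1)"
    using arg_cong[OF isotropic_count_0[OF a], of int] p_ge_3 by (simp add: of_nat_diff)
  have pm: "int p ^ m = int p * int p ^ (m - 1)"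
    using m_pos by (cases m) auto
  have "int p * (int (qcount 0) - int (isotropic_count a 0)) = int p * ((int p - 1) * v)"
  proof -
    have "int p * ((int p - 1) * v) = (int p - 1) * (int p * v)"
      by (simp only: mult_ac)
    then show ?thesis
      using iso0 unfolding v pm by (simp add: algebra_simps)
  qed
  then have iso: "int (qcount 0) - int (isotropic_count a 0) = (int p - 1) * v"
    using p_ge_3 by simp
  show ?thesis
  proof (cases "b = 0")
    case True
    have "hamming_weight (codeword p m ds a b) =
        card ({x. Tr (x ^ 2) = 0} - {x. Tr (a * x) = 0 \<and> Tr (x ^ 2) = 0})"
      unfolding hamming_weight_codeword[OF ds]
      by (intro arg_cong[of _ _ card]) (auto simp: True)
    also have "\<dots> = qcount 0 - isotropic_count a 0"
      unfolding isotropic_count_def qcount_def by (rule card_Diff_subset) auto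
    finally show ?thesis
      using iso le[of 0] True by (simp add: of_nat_diff)
  next
    case False
    have "hamming_weight (codeword p m ds a b) =
        card ({x. Tr (x ^ 2) = 0} - {0} - {x. Tr (a * x) = - b \<and> Tr (x ^ 2) = 0})"
      unfolding hamming_weight_codeword[OF ds]
      by (intro arg_cong[of _ _ card]) (auto simp: eq_neg_iff_add_eq_0)
    also have "\<dots> = card ({x. Tr (x ^ 2) = 0} - {0}) - isotropic_count a (- b)"
      unfolding isotropic_count_def qcount_def using False by (intro card_Diff_subset) auto
    also have "card ({x. Tr (x ^ 2) = 0} - {0}) = qcount 0 - 1"
      unfolding qcount_def by (subst card_Diff_subset) auto
    finally have w: "hamming_weight (codeword p m ds a b) = qcount 0 - 1 - isotropic_count a (- b)" .
    \<comment> \<open>The zero vector is isotropic and lies on the hyperplane through the origin;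
      this keeps the natural subtraction in \<open>w\<close> from truncating.\<close>
    have "isotropic_count a 0 \<ge> 1"
    proof -
      have "0 \<in> {x. Tr (a * x) = 0 \<and> Tr (x ^ 2) = 0}"
        by simp
      then show ?thesis
        unfolding isotropic_count_def Suc_le_eq One_nat_def card_gt_0_iff by (intro conjI finite) blast
    qed
    moreover have nz: "isotropic_count a 0 + (p - 1) * isotropic_count a (- b) = qcount 0"
      using b False by (intro isotropic_count_nonzero) auto
    moreover have "1 * isotropic_count a (- b) \<le> (p - 1) * isotropic_count a (- b)"
      using p_ge_3 by (intro mult_right_mono) auto
    ultimately have "isotropic_count a (- b) + 1 \<le> qcount 0"
      by linarith
    moreover have "(int p - 1) * int (isotropic_count a (- b)) = (int p - 1) * v"
      using arg_cong[OF nz, of int] iso p_ge_3 by (simp add: of_nat_diff eq_diff_eq[symmetric])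
    then have "int (isotropic_count a (- b)) = v"
      using p_ge_3 by simp
    ultimately show ?thesis
      using w False by (simp add: of_nat_diff)
  qed
qed

lemma hamming_weight_codeword_0:
  assumes "distinct ds" "set ds = defining_set p m"
  shows "int (hamming_weight (codeword p m ds 0 b)) = (if b = (0::'a) then 0 else int (qcount 0) - 1)"
proof (cases "b = 0")
  case False
  have "hamming_weight (codeword p m ds 0 b) = card ({x. Tr (x ^ 2) = 0} - {0})"
    unfolding hamming_weight_codeword[OF assms]
    by (intro arg_cong[of _ _ card]) (auto simp: False)
  also have "\<dots> = qcount 0 - 1"
    unfolding qcount_def by (subst card_Diff_subset) auto
  finally show ?thesis
    using False qcount_0_pos by (simp add: of_nat_diff)
qed (simp add: hamming_weight_codeword[OF assms])

text \<open>For nonzero \<open>a\<close> the weight depends on \<open>a\<close> only through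
  \<open>t = Tr (a ^ 2)\<close>, and on \<open>b\<close> only through whether \<open>b = 0\<close>.
  The first two summands account for \<open>a = 0\<close>, which is therefore removed from the class
  \<open>t = 0\<close>.\<close>

lemma family_weight_count_eq:
  assumes ds: "distinct (ds :: 'a list)" "set ds = defining_set p m"
    and v: "\<And>t. t \<in> P \<Longrightarrow> int p * v t = int (qcount 0) - int (qcount t) + int p ^ (m - 1)"
  shows "int (family_weight_count p m ds i) =
    of_bool (0 = int i) + (int p - 1) * of_bool (int (qcount 0) - 1 = int i)
    + (\<Sum>t\<in>P. (int (qcount t) - of_bool (t = 0)) *
        (of_bool ((int p - 1) * v t = int i) +
         (int p - 1) * of_bool (int (qcount 0) - 1 - v t = int i)))"
proof -
  let ?w = "\<lambda>a b. int (hamming_weight (codeword p m ds a b))"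
  define g where "g t = of_bool ((int p - 1) * v t = int i) +
         (int p - 1) * of_bool (int (qcount 0) - 1 - v t = int i)" for t
  have split: "(\<Sum>b\<in>P. of_bool ((if b = 0 then y else z) = int i)) =
      of_bool (y = int i) + (int p - 1) * of_bool (z = int i)" for y z :: int
  proof -
    have "(\<Sum>b\<in>P. of_bool ((if b = 0 then y else z) = int i)) =
        of_bool (y = int i) + (\<Sum>b\<in>P - {0}. of_bool (z = int i) :: int)"
      by (subst sum.remove[of _ 0]) auto
    then show ?thesis
      using p_ge_3 by (simp add: card_P of_nat_diff)
  qed
  have "{(a, b). b \<in> P \<and> hamming_weight (codeword p m ds a b) = i} =
      (SIGMA a:UNIV. {b \<in> P. ?w a b = int i})"
    by auto
  then have "int (family_weight_count p m ds i) = (\<Sum>a\<in>UNIV. \<Sum>b\<in>P. of_bool (?w a b = int i))"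
    unfolding family_weight_count_def by (simp add: Int_def)
  also have "\<dots> = (\<Sum>b\<in>P. of_bool (?w 0 b = int i)) + (\<Sum>a\<in>UNIV - {0}. \<Sum>b\<in>P. of_bool (?w a b = int i))"
    by (subst sum.remove[of _ 0]) auto
  also have "(\<Sum>b\<in>P. of_bool (?w 0 b = int i)) =
      of_bool (0 = int i) + (int p - 1) * of_bool (int (qcount 0) - 1 = int i)"
    unfolding hamming_weight_codeword_0[OF ds] by (rule split)
  also have "(\<Sum>a\<in>UNIV - {0}. \<Sum>b\<in>P. of_bool (?w a b = int i)) = (\<Sum>a\<in>UNIV - {0}. g (Tr (a ^ 2)))"
  proof (rule sum.cong[OF refl])
    fix a :: 'a assume a: "a \<in> UNIV - {0}"
    have "(\<Sum>b\<in>P. of_bool (?w a b = int i)) = (\<Sum>b\<in>P. of_bool ((if b = 0 then (int p - 1) * v (Tr (a ^ 2))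
        else int (qcount 0) - 1 - v (Tr (a ^ 2))) = int i) :: int)"
      using a by (intro sum.cong refl) (subst hamming_weight_codeword_eq[OF ds _ _ v[OF Tr_in_P]], auto)
    then show "(\<Sum>b\<in>P. of_bool (?w a b = int i)) = g (Tr (a ^ 2))"
      by (simp only: split g_def)
  qed
  also have "\<dots> = (\<Sum>t\<in>P. g t * int (qcount t)) - g 0"
    unfolding sum_qcount by (subst sum_diff) auto
  also have "\<dots> = (\<Sum>t\<in>P. (int (qcount t) - of_bool (t = 0)) * g t)"
  proof -
    have "(\<Sum>t\<in>P. of_bool (t = 0) * g t) = g 0"
      by (subst sum.remove[of _ 0]) auto
    then show ?thesis
      by (simp add: left_diff_distrib right_diff_distrib sum_subtractf mult.commute)
  qed
  finally show ?thesis
    by (simp add: g_def)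
qed

section \<open>Squares, and the quadratic form in odd degree\<close>

lemma half_order: "2 * ((p ^ m - 1) div 2) = p ^ m - 1"
  using odd_p by simp

lemma half_order_pos: "(p ^ m - 1) div 2 > 0"
proof -
  have "p ^ 1 \<le> p ^ m"
    using p_ge_3 m_pos by (intro power_increasing) auto
  then show ?thesis
    using p_ge_3 by simp
qed

lemma card_square_roots_le: "card {x::'a. x ^ 2 = w} \<le> 2"
  by (rule card_roots_power_le) simp

lemma card_square_roots:
  assumes "(y::'a) \<noteq> 0"
  shows "card {x. x ^ 2 = y ^ 2} = 2"
proof -
  have "{x. x ^ 2 = y ^ 2} = {y, - y}"
    by (auto simp: power2_eq_iff)
  moreover have "y \<noteq> - y"
  proof
    assume "y = - y"
    then have "2 * y = 0"
      by (metis add.right_inverse mult_2)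
    then show False
      using assms two_neq_0 by simp
  qed
  ultimately show ?thesis
    by simp
qed

text \<open>A square has at most two roots, so at least half of the nonzero elements are squares.
  All of these solve an equation with at most that many roots.\<close>

lemma euler_criterion_field:
  assumes "(x::'a) \<noteq> 0"
  shows "(\<exists>y. x = y ^ 2) \<longleftrightarrow> x ^ ((p ^ m - 1) div 2) = 1"
proof -
  let ?N = "(p ^ m - 1) div 2"
  let ?S = "(\<lambda>y::'a. y ^ 2) ` (UNIV - {0})"
  have "?S \<subseteq> {x. x ^ ?N = 1}"
    using power_card_minus_1 by (auto simp only: half_order power_mult[symmetric])
  moreover have "card {x::'a. x ^ ?N = 1} \<le> card ?S"
  proof -
    have "2 * ?N = card (UNIV - {0::'a})"
      using card_field half_order by (simp add: card_Diff_subset)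
    also have "\<dots> \<le> (\<Sum>w\<in>?S. card {x::'a. x ^ 2 = w})"
    proof -
      have "UNIV - {0::'a} \<subseteq> {x. True \<and> x ^ 2 \<in> ?S}"
        by auto
      then show ?thesis
        using card_mono[of "{x. True \<and> x ^ 2 \<in> ?S}" "UNIV - {0::'a}"]
          card_vimage_eq_sum[of ?S "\<lambda>_. True" "\<lambda>x. x ^ 2"] by simp
    qed
    also have "\<dots> \<le> (\<Sum>w\<in>?S. 2)"
      by (intro sum_mono card_square_roots_le)
    finally have "?N \<le> card ?S"
      by simp
    moreover have "card {x::'a. x ^ ?N = 1} \<le> ?N"
      using half_order_pos by (rule card_roots_power_le)
    ultimately show ?thesis
      by simp
  qed
  ultimately have "?S = {x. x ^ ?N = 1}"
    by (intro card_seteq) auto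
  then show ?thesis
    using assms by fastforce
qed

lemma nonsquare_power:
  assumes "\<nexists>y. (x::'a) = y ^ 2"
  shows "x ^ ((p ^ m - 1) div 2) = - 1"
proof -
  have x: "x \<noteq> 0"
    using assms by (metis power_zero_numeral)
  have "(x ^ ((p ^ m - 1) div 2)) ^ 2 = 1"
    using power_card_minus_1[OF x] half_order by (simp add: power_mult[symmetric] mult.commute)
  then show ?thesis
    using euler_criterion_field[OF x] assms by (auto simp: power2_eq_1_iff)
qed

text \<open>For nonzero \<open>w\<close> exactly one of \<open>w\<close> and \<open>w / c\<close> is
  a square, and it has two roots; for \<open>w = 0\<close> both sets are \<open>{0}\<close>.\<close>

lemma card_scaled_square_roots:
  assumes "\<nexists>y. (c::'a) = y ^ 2"
  shows "card {x. x ^ 2 = w} + card {x. c * x ^ 2 = w} = 2"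
proof -
  have c: "c \<noteq> 0"
    using assms by (metis power_zero_numeral)
  have eq: "{x. c * x ^ 2 = w} = {x. x ^ 2 = w / c}"
    using c by (auto simp: field_simps)
  consider "w = 0" | "w \<noteq> 0" "\<exists>y. w = y ^ 2" | "\<nexists>y. w = y ^ 2"
    by blast
  then show ?thesis
  proof cases
    case 1
    then show ?thesis
      using c by simp
  next
    case 2
    then obtain y where y: "w = y ^ 2" "y \<noteq> 0"
      by auto
    have none: "\<not> c * x ^ 2 = w" for x
    proof
      assume "c * x ^ 2 = w"
      moreover from this have "x \<noteq> 0"
        using y by auto
      ultimately have "c = (y / x) ^ 2"
        using y by (simp add: power_divide eq_divide_eq)
      then show False
        using assms by blast
    qed
    show ?thesis
      using none by (simp add: y(1) card_square_roots y(2))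
  next
    case 3
    have w: "w \<noteq> 0"
      using 3 by (metis power_zero_numeral)
    have "(w / c) ^ ((p ^ m - 1) div 2) = 1"
      unfolding power_divide nonsquare_power[OF 3] nonsquare_power[OF assms] by simp
    then obtain z where z: "w / c = z ^ 2"
      using euler_criterion_field[of "w / c"] w c by auto
    then have "z \<noteq> 0"
      using w c by auto
    moreover have "{x. x ^ 2 = w} = {}"
      using 3 by auto
    ultimately show ?thesis
      unfolding eq z by (simp add: card_square_roots)
  qed
qed

lemma qcount_nonsquare_multiple:
  assumes c: "\<nexists>y. c = y ^ 2" and t: "t \<in> P"
  shows "qcount t + card {x. Tr (c * x ^ 2) = t} = 2 * p ^ (m - 1)"
proof -
  let ?B = "{w. Tr w = t}"
  have "qcount t = (\<Sum>w\<in>?B. card {x::'a. x ^ 2 = w})"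
    unfolding qcount_def using card_vimage_eq_sum[of ?B "\<lambda>_. True" "\<lambda>x. x ^ 2"] by simp
  moreover have "card {x. Tr (c * x ^ 2) = t} = (\<Sum>w\<in>?B. card {x::'a. c * x ^ 2 = w})"
    using card_vimage_eq_sum[of ?B "\<lambda>_. True" "\<lambda>x. c * x ^ 2"] by simp
  ultimately have "qcount t + card {x. Tr (c * x ^ 2) = t} = (\<Sum>w\<in>?B. 2)"
    by (simp only: sum.distrib[symmetric] card_scaled_square_roots[OF c])
  also have "\<dots> = 2 * p ^ (m - 1)"
    using card_Tr_mult_fibre[of 1 t] t by simp
  finally show ?thesis .
qed

text \<open>The geometric sum is the index of the nonzero elements of \<open>P\<close> in the
  multiplicative group. Its parity, which is that of \<open>m\<close>, governs the square roots of
  elements of \<open>P\<close>.\<close>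

lemma pred_p_times_index: "(p - 1) * (\<Sum>i<m. p ^ i) = p ^ m - 1"
  using power_diff_1_eq[of "int p" m] p_ge_3
  by (simp add: of_nat_diff flip: of_nat_eq_iff[where 'a = int])

lemma parity_index: "even (\<Sum>i<m. p ^ i) \<longleftrightarrow> even m"
proof -
  have "even (\<Sum>i<k. p ^ i) \<longleftrightarrow> even k" for k
    using odd_p by (induction k) auto
  then show ?thesis .
qed

text \<open>The second moment counts pairs \<open>(x, y)\<close> with equal form values. Putting
  \<open>x = z + y\<close> makes the condition linear in \<open>y\<close>: \<open>z = 0\<close>
  contributes \<open>p ^ m\<close> pairs, every other \<open>z\<close> contributes
  \<open>p ^ (m - 1)\<close>.\<close>

lemma sum_qcount_square: "(\<Sum>t\<in>P. (int (qcount t)) ^ 2) = int (p ^ m) + (int (p ^ m) - 1) * int (p ^ (m - 1))"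
proof -
  have "(\<Sum>t\<in>P. (int (qcount t)) ^ 2) = (\<Sum>y\<in>UNIV. int (qcount (Tr (y ^ 2))))"
    using sum_qcount[of "\<lambda>t. int (qcount t)"] by (simp add: power2_eq_square)
  also have "\<dots> = (\<Sum>y\<in>UNIV. int (card {z \<in> UNIV. Tr (2 * z * y) = - Tr (z ^ 2)}))"
  proof (rule sum.cong[OF refl])
    fix y
    have *: "Tr ((z + y) ^ 2) = Tr (y ^ 2) \<longleftrightarrow> Tr (2 * z * y) = - Tr (z ^ 2)" for z
      using Tr_scale[OF two_in_P, of "z * y"]
      by (simp add: Tr_square_add eq_neg_iff_add_eq_0 mult_ac add.commute)
    have "{x. Tr (x ^ 2) = Tr (y ^ 2)} = (\<lambda>z. z + y) ` {z. Tr (2 * z * y) = - Tr (z ^ 2)}"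
      (is "?L = _ ` ?R")
    proof
      show "?L \<subseteq> (\<lambda>z. z + y) ` ?R"
      proof
        fix x assume "x \<in> ?L"
        then have "x - y \<in> ?R"
          using *[of "x - y"] by simp
        then show "x \<in> (\<lambda>z. z + y) ` ?R"
          by (rule rev_image_eqI) simp
      qed
    qed (auto simp: *)
    then show "int (qcount (Tr (y ^ 2))) = int (card {z \<in> UNIV. Tr (2 * z * y) = - Tr (z ^ 2)})"
      unfolding qcount_def by (simp add: card_image)
  qed
  also have "\<dots> = int (\<Sum>z\<in>UNIV. card {y \<in> UNIV. Tr (2 * z * y) = - Tr (z ^ 2)})"
    by (subst sum_card_swap[symmetric]) auto
  also have "\<dots> = int (p ^ m) + (\<Sum>z\<in>UNIV - {0::'a}. int (p ^ (m - 1)))"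
  proof -
    have "card {y \<in> UNIV. Tr (2 * z * y) = - Tr (z ^ 2)} = p ^ (m - 1)" if "z \<noteq> 0" for z
      using card_Tr_mult_fibre[of "2 * z" "- Tr (z ^ 2)"] that two_neq_0 by auto
    then show ?thesis
      using card_field by (subst sum.remove[of _ 0]) auto
  qed
  also have "\<dots> = int (p ^ m) + (int (p ^ m) - 1) * int (p ^ (m - 1))"
    using card_field p_ge_3 by (simp add: card_Diff_subset of_nat_diff)
  finally show ?thesis .
qed

section \<open>Level sets in odd degree\<close>

lemma exists_nonsquare_P: "\<exists>u\<in>P. \<nexists>r. r \<in> P \<and> u = r ^ 2"
proof -
  \<comment> \<open>Since \<open>1\<close> and \<open>- 1\<close> are distinct with the same square,
    squaring is not injective on the finite set \<open>P\<close>, hence not onto.\<close>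
  have "\<not> inj_on (\<lambda>r::'a. r ^ 2) P"
  proof
    assume "inj_on (\<lambda>r::'a. r ^ 2) P"
    then have "(1::'a) = - 1"
      by (rule inj_onD) auto
    then have "(2::'a) = 0"
      by (metis one_add_one add.right_inverse)
    then show False
      using two_neq_0 by simp
  qed
  then have "(\<lambda>r. r ^ 2) ` P \<noteq> P"
    using eq_card_imp_inj_on[of P "\<lambda>r. r ^ 2"] by auto
  moreover have "(\<lambda>r. r ^ 2) ` P \<subseteq> P"
    by auto
  ultimately show ?thesis
    by blast
qed

text \<open>For nonzero \<open>y\<close>, the power \<open>y ^ (p - 1)\<close> squares to
  \<open>1\<close>. It is not \<open>- 1\<close>, because raised to the odd index it gives
  \<open>y ^ (p ^ m - 1) = 1\<close>.\<close>

lemma odd_square_root_in_P: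
  assumes "odd m" and "y ^ 2 \<in> P"
  shows "(y::'a) \<in> P"
proof (cases "y = 0")
  case False
  have "(y ^ (p - 1)) ^ 2 = 1"
    using P_power_minus_1[OF assms(2)] False by (simp add: power_mult[symmetric] mult.commute)
  moreover have "y ^ (p - 1) \<noteq> - 1"
  proof
    assume *: "y ^ (p - 1) = - 1"
    have "(y ^ (p - 1)) ^ (\<Sum>i<m. p ^ i) = 1"
      using power_card_minus_1[OF False] by (simp only: power_mult[symmetric] pred_p_times_index)
    then have "(- 1 :: 'a) = 1"
      using assms(1) by (simp only: * parity_index uminus_power_if power_one if_False)
    then have "(2::'a) = 0"
      by (metis one_add_one add.right_inverse)
    then show False
      using two_neq_0 by simp
  qed
  ultimately have "y ^ (p - 1) = 1"
    by (auto simp: power2_eq_1_iff)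
  then show ?thesis
    using p_ge_3 by (simp add: P_iff power_eq_if[of _ p])
qed simp

text \<open>A multiplier from \<open>P\<close> passes through the trace, so the twisted form has the
  level sets of the original one at rescaled values.\<close>

lemma qcount_nonsquare_odd:
  assumes "u \<in> P" "\<nexists>y. u = y ^ 2" and t: "t \<in> P"
  shows "qcount t + qcount (t / u) = 2 * p ^ (m - 1)"
proof -
  have "u \<noteq> 0"
    using assms(2) by (metis power_zero_numeral)
  then have "{x. Tr (u * x ^ 2) = t} = {x. Tr (x ^ 2) = t / u}"
    by (auto simp: Tr_scale[OF assms(1)] eq_divide_eq mult.commute)
  then show ?thesis
    using qcount_nonsquare_multiple[OF assms(2) t] by (simp add: qcount_def)
qed

lemma qcount_odd_0:
  assumes "odd m"
  shows "qcount 0 = p ^ (m - 1)"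
proof -
  obtain u where "u \<in> P" "\<nexists>r. r \<in> P \<and> u = r ^ 2"
    using exists_nonsquare_P by blast
  then have "\<nexists>y. u = y ^ 2"
    using odd_square_root_in_P[OF assms] by blast
  then show ?thesis
    using qcount_nonsquare_odd[OF \<open>u \<in> P\<close>, of 0] by simp
qed

text \<open>The deviation from the mean is the same at all nonzero squares and opposite at
  nonsquares, so its square is a constant \<open>k\<close>. As \<open>t = 0\<close> does not
  deviate, the second moment determines \<open>(p - 1) * k\<close>.\<close>

lemma qcount_odd:
  assumes "odd m" and "t \<in> P" and "t \<noteq> 0"
  shows "int (qcount t) = int p ^ (m - 1) + int p ^ ((m - 1) div 2) \<or>
         int (qcount t) = int p ^ (m - 1) - int p ^ ((m - 1) div 2)"
proof -
  let ?M = "int p ^ (m - 1)"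
  define k where "k = (int (qcount 1) - ?M) ^ 2"
  have k: "(int (qcount s) - ?M) ^ 2 = k" if s: "s \<in> P" "s \<noteq> 0" for s
  proof (cases "\<exists>y. s = y ^ 2")
    case True
    then obtain y where "s = y ^ 2" "y \<in> P"
      using odd_square_root_in_P[OF assms(1)] s by blast
    then show ?thesis
      using qcount_square[of y] s by (auto simp: k_def)
  next
    case False
    have "qcount s + qcount 1 = 2 * p ^ (m - 1)"
      using qcount_nonsquare_odd[OF s(1) False s(1)] s by simp
    then have "int (qcount s) + int (qcount 1) = 2 * ?M"
      by (metis of_nat_add of_nat_mult of_nat_numeral of_nat_power)
    then have "int (qcount s) - ?M = - (int (qcount 1) - ?M)"
      by simp
    then show ?thesis
      unfolding k_def by (metis power2_minus)
  qed
  have pm: "int p ^ m = int p * ?M"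
    using m_pos by (cases m) auto
  have "(\<Sum>s\<in>P. (int (qcount s) - ?M) ^ 2) = (\<Sum>s\<in>P. (int (qcount s)) ^ 2)
      - 2 * ?M * (\<Sum>s\<in>P. int (qcount s)) + int p * ?M ^ 2"
    by (simp add: power2_diff sum.distrib sum_subtractf sum_distrib_left card_P mult_ac)
  also have "\<dots> = (int p - 1) * ?M"
    unfolding sum_qcount_square sum_qcount_eq by (simp add: pm algebra_simps power2_eq_square)
  finally have "(\<Sum>s\<in>P. (int (qcount s) - ?M) ^ 2) = (int p - 1) * ?M" .
  moreover have "(\<Sum>s\<in>P. (int (qcount s) - ?M) ^ 2) = (\<Sum>s\<in>P - {0}. k)"
  proof (subst sum.remove[of _ 0])
    show "(int (qcount 0) - ?M) ^ 2 + (\<Sum>s\<in>P - {0}. (int (qcount s) - ?M) ^ 2) = (\<Sum>s\<in>P - {0::'a}. k)"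
      unfolding qcount_odd_0[OF assms(1)]
      by (subst sum.cong[OF refl k]) auto
  qed auto
  moreover have "(\<Sum>s\<in>P - {0::'a}. k) = (int p - 1) * k"
    using p_ge_3 by (simp add: card_P of_nat_diff)
  ultimately have "(int p - 1) * k = (int p - 1) * ?M"
    by metis
  then have "k = ?M"
    using p_ge_3 by simp
  moreover have "?M = (int p ^ ((m - 1) div 2)) ^ 2"
    using assms(1) by (simp add: power_mult[symmetric])
  ultimately have "(int (qcount t) - ?M) ^ 2 = (int p ^ ((m - 1) div 2)) ^ 2"
    using k[OF assms(2,3)] by simp
  then show ?thesis
    by (auto simp: power2_eq_iff)
qed

text \<open>The total \<open>p ^ m\<close> forces the deviations over nonzero \<open>t\<close> to
  cancel, so both signs occur equally often.\<close>

lemma card_qcount_odd: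
  assumes "odd m"
  shows "2 * int (card {t \<in> P - {0}. int (qcount t) = int p ^ (m - 1) + int p ^ ((m - 1) div 2)}) = int p - 1"
    and "2 * int (card {t \<in> P - {0}. int (qcount t) = int p ^ (m - 1) - int p ^ ((m - 1) div 2)}) = int p - 1"
proof -
  let ?M = "int p ^ (m - 1)" and ?h = "int p ^ ((m - 1) div 2)"
  let ?A = "{t \<in> P - {0}. int (qcount t) = ?M + ?h}"
  let ?B = "{t \<in> P - {0}. int (qcount t) = ?M - ?h}"
  have h: "?h > 0"
    using p_ge_3 by simp
  have AB: "P - {0} = ?A \<union> ?B" "?A \<inter> ?B = {}"
    using qcount_odd[OF assms] h by auto
  have "int p - 1 = int (card (P - {0::'a}))"
    using p_ge_3 by (simp add: card_P of_nat_diff)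
  also have "\<dots> = int (card ?A) + int (card ?B)"
    by (subst AB(1), subst card_Un_disjoint) (use AB(2) in auto)
  finally have 1: "int (card ?A) + int (card ?B) = int p - 1" ..
  have pm: "int p ^ m = int p * ?M"
    using m_pos by (cases m) auto
  have "int p * ?M = ?M + (\<Sum>t\<in>P - {0}. int (qcount t))"
    unfolding pm[symmetric] sum_qcount_eq[symmetric] using qcount_odd_0[OF assms]
    by (subst sum.remove[of _ 0]) auto
  also have "(\<Sum>t\<in>P - {0}. int (qcount t)) = (\<Sum>t\<in>?A. int (qcount t)) + (\<Sum>t\<in>?B. int (qcount t))"
    by (subst AB(1), subst sum.union_disjoint) (use AB(2) in auto)
  also have "\<dots> = (?M + ?h) * int (card ?A) + (?M - ?h) * int (card ?B)"
    by simp
  finally have "(int p - 1) * ?M = ?M * (int (card ?A) + int (card ?B)) + ?h * (int (card ?A) - int (card ?B))"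
    by (simp add: algebra_simps)
  then have "?h * (int (card ?A) - int (card ?B)) = 0"
    unfolding 1 by simp
  then have "int (card ?A) = int (card ?B)"
    using h unfolding mult_eq_0_iff by linarith
  then show "2 * int (card ?A) = int p - 1" "2 * int (card ?B) = int p - 1"
    using 1 by linarith+
qed

section \<open>The quadratic form in even degree\<close>

lemma card_eigenspace_frobenius_le:
  assumes "k > 0"
  shows "card {x::'a. x ^ (p ^ k) = c * x} \<le> p ^ k"
proof -
  let ?S = "{x::'a. x ^ (p ^ k - 1) = c}"
  have pk: "p ^ k > 1"
    using p_ge_3 assms by (intro one_less_power) auto
  have "{x. x ^ (p ^ k) = c * x} \<subseteq> insert 0 ?S"
    using pk p_ge_3 by (auto simp: power_eq_if[of _ "p ^ k"])
  then have "card {x. x ^ (p ^ k) = c * x} \<le> card (insert 0 ?S)"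
    by (intro card_mono) auto
  also have "\<dots> \<le> Suc (card ?S)"
    by (simp add: card_insert_if)
  also have "card ?S \<le> p ^ k - 1"
    using pk by (intro card_roots_power_le) auto
  finally show ?thesis
    using pk by simp
qed

end

section \<open>Conjugation over the subfield of half the degree\<close>

locale even_field_extension = field_extension p m type
  for p m :: nat and type :: "'a::finite_field itself" +
  fixes k :: nat
  assumes m_eq: "m = 2 * k"
begin

abbreviation conj_field :: "'a \<Rightarrow> 'a" where
  "conj_field x \<equiv> x ^ (p ^ k)"

definition subfield :: "'a set" where
  "subfield = {x. conj_field x = x}"

lemma k_pos: "k > 0"
  using m_pos m_eq by simp

lemma conj_conj: "conj_field (conj_field x) = x"
proof -
  have "conj_field (conj_field x) = x ^ (p ^ m)"
    by (simp add: m_eq power_mult[symmetric] power_add[symmetric] mult_2)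
  then show ?thesis
    using finite_field_power_card_eq_same[of x] card_field by simp
qed

text \<open>Root counting gives the upper bound. For the lower one, \<open>y - conj_field y\<close>
  maps the field into the at most \<open>p ^ k\<close> antisymmetric elements, with fibres no larger
  than the subfield.\<close>

lemma card_subfield: "card subfield = p ^ k"
proof (rule antisym)
  show "card subfield \<le> p ^ k"
    using card_eigenspace_frobenius_le[OF k_pos, of 1] by (simp add: subfield_def)
  let ?f = "\<lambda>y. y - conj_field y"
  let ?B = "{z::'a. conj_field z = - 1 * z}"
  have "p ^ k * p ^ k = card {y. True \<and> ?f y \<in> ?B}"
    using card_field by (simp add: frobenius_diff conj_conj m_eq mult_2 power_add)
  also have "\<dots> = (\<Sum>z\<in>?B. card {y. True \<and> ?f y = z})"
    by (rule card_vimage_eq_sum) simp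
  also have "\<dots> \<le> (\<Sum>z\<in>?B. card subfield)"
  proof (rule sum_mono)
    fix z
    show "card {y. True \<and> ?f y = z} \<le> card subfield"
    proof (cases "\<exists>y. ?f y = z")
      case True
      then obtain y where y: "?f y = z"
        by blast
      have "u - y \<in> subfield" if "?f u = z" for u
      proof -
        have "conj_field (u - y) = (u - y) - (?f u - ?f y)"
          by (simp add: frobenius_diff)
        then show ?thesis
          unfolding subfield_def that y by simp
      qed
      then have "(\<lambda>u. u - y) ` {u. True \<and> ?f u = z} \<subseteq> subfield"
        by blast
      then show ?thesis
        by (intro card_inj_on_le[of "\<lambda>u. u - y"]) (auto simp: inj_on_def)
    qed simp
  qed
  also have "\<dots> = card ?B * card subfield"
    by simp
  also have "\<dots> \<le> p ^ k * card subfield"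
    by (intro mult_right_mono card_eigenspace_frobenius_le k_pos) simp
  finally show "p ^ k \<le> card subfield"
    using p_ge_3 by simp
qed

text \<open>Transitivity of the trace: \<open>z + conj_field z\<close> is the trace down to the
  subfield, followed by the trace of the subfield.\<close>

lemma Tr_even: "Tr z = (\<Sum>i<k. (z + conj_field z) ^ (p ^ i))"
proof -
  have "Tr z = (\<Sum>i<k. z ^ (p ^ i)) + (\<Sum>i<k. z ^ (p ^ (k + i)))"
    unfolding field_trace_def m_eq mult_2 lessThan_atLeast0
    by (simp add: sum.atLeastLessThan_concat[of 0 k "k + k", symmetric]
        sum.shift_bounds_nat_ivl[of _ 0 k k, simplified] add.commute)
  then show ?thesis
    by (simp add: frobenius_add sum.distrib power_add power_mult)
qed

lemma exists_antisymmetric: "\<exists>c. c \<noteq> 0 \<and> conj_field c = - c"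
proof -
  have "p ^ k < p ^ m"
    using p_ge_3 k_pos m_eq by (intro power_strict_increasing) auto
  then have "subfield \<noteq> UNIV"
    using card_subfield card_field by auto
  then obtain y where "y \<notin> subfield"
    by blast
  then have "y - conj_field y \<noteq> 0" "conj_field (y - conj_field y) = - (y - conj_field y)"
    by (auto simp: subfield_def frobenius_diff conj_conj)
  then show ?thesis
    by blast
qed

text \<open>
  The form vanishes on the subfield, which is its own orthogonal complement, so the form is
  equidistributed on every other coset of the subfield.
\<close>

lemma card_antisymmetric_form:
  assumes c: "c \<noteq> 0" "conj_field c = - c"
  shows "int p * int (card {x. Tr (c * x ^ 2) = 0}) = int p ^ (k + 1) + int p ^ m - int p ^ k"
proof -
  \<comment> \<open>For \<open>x\<close> in the subfield, \<open>c * x\<close> is antisymmetric, so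
    every summand in \<open>Tr_even\<close> is zero.\<close>
  have iso: "Tr (c * x) = 0" if "x \<in> subfield" for x
    using that c(2) p_ge_3 unfolding Tr_even
    by (intro sum.neutral) (auto simp: subfield_def power_mult_distrib)
  have mult: "x * y \<in> subfield" if "x \<in> subfield" "y \<in> subfield" for x y
    using that by (simp add: subfield_def power_mult_distrib)
  have add: "x + y \<in> subfield" if "x \<in> subfield" "y \<in> subfield" for x y
    using that by (simp add: subfield_def frobenius_add)
  have scale: "r * x \<in> subfield" if "r \<in> P" "x \<in> subfield" for r x
    using that by (simp add: subfield_def power_mult_distrib P_frobenius)
  have expand: "Tr (c * (x + w) ^ 2) = Tr (c * x ^ 2) + 2 * Tr (c * x * w)" if "w \<in> subfield" for x w
  proof -
    have "c * (x + w) ^ 2 = c * x ^ 2 + 2 * (c * x * w) + c * w ^ 2"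
      by (simp add: power2_eq_square algebra_simps)
    moreover have "Tr (c * w ^ 2) = 0"
      using that by (intro iso) (simp add: power2_eq_square mult)
    ultimately show ?thesis
      by (simp only: Tr_add Tr_scale[OF two_in_P] add_0_right)
  qed
  have fibre: "p * card {w \<in> subfield. Tr (c * x ^ 2) + 2 * Tr (c * x * w) = 0} = p ^ k"
    if x: "x \<notin> subfield" for x
  proof -
    \<comment> \<open>\<open>?d * w\<close> is the trace of \<open>c * x * w\<close> down to the
      subfield. It takes \<open>p ^ k > p ^ (k - 1)\<close> values as \<open>w\<close> varies, so
      one of them survives the remaining trace.\<close>
    let ?d = "c * (x - conj_field x)"
    have d: "?d \<noteq> 0"
      using x c by (simp add: subfield_def)
    have "card ((*) ?d ` subfield) = p ^ k"
      using d card_subfield by (subst card_image) (auto simp: inj_on_def)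
    then have "card ((*) ?d ` subfield) > p ^ (k - 1)"
      using p_ge_3 k_pos by simp
    then obtain w where w: "w \<in> subfield" "(\<Sum>i<k. (?d * w) ^ (p ^ i)) \<noteq> 0"
      using exists_linearized_nonroot[OF k_pos] by blast
    have "c * x * w + conj_field (c * x * w) = ?d * w"
      using c(2) w(1) by (simp add: subfield_def power_mult_distrib algebra_simps)
    then have "Tr (c * x * w) \<noteq> 0"
      using w(2) by (simp add: Tr_even)
    then have "p * card {w \<in> subfield. Tr (c * x * w) = - Tr (c * x ^ 2) / 2} = card subfield"
      using w(1) by (intro card_Tr_mult_fibre_subspace add scale P_divide P_uminus two_in_P Tr_in_P)
    moreover have "s + 2 * r = 0 \<longleftrightarrow> r = - s / 2" for r s :: 'a
      by (simp only: nonzero_eq_divide_eq[OF two_neq_0] eq_neg_iff_add_eq_0 mult.commute add.commute)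
    ultimately show ?thesis
      by (simp add: card_subfield)
  qed
  let ?E = "card {x. Tr (c * x ^ 2) = 0}"
  \<comment> \<open>Double count of the pairs \<open>(x, w)\<close> for which \<open>x + w\<close>
    is a zero of the form. By translation each \<open>w\<close> contributes \<open>?E\<close>; each
    \<open>x\<close> in the subfield contributes \<open>p ^ k\<close>, each other \<open>x\<close> a
    \<open>p\<close>-th part of that.\<close>
  have "p ^ k * ?E = (\<Sum>w\<in>subfield. card {x \<in> UNIV. Tr (c * x ^ 2) + 2 * Tr (c * x * w) = 0})"
  proof -
    have "card {x \<in> UNIV. Tr (c * x ^ 2) + 2 * Tr (c * x * w) = 0} = ?E" if "w \<in> subfield" for w
    proof -
      have "{x. Tr (c * x ^ 2) = 0} =
          (\<lambda>x. x + w) ` {x \<in> UNIV. Tr (c * x ^ 2) + 2 * Tr (c * x * w) = 0}" (is "?L = _ ` ?R")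
      proof
        show "?L \<subseteq> (\<lambda>x. x + w) ` ?R"
        proof
          fix x assume "x \<in> ?L"
          then have "x - w \<in> ?R"
            using expand[OF that, of "x - w"] by simp
          then show "x \<in> (\<lambda>x. x + w) ` ?R"
            by (rule rev_image_eqI) simp
        qed
      qed (auto simp: expand[OF that])
      then show ?thesis
        by (simp add: card_image)
    qed
    then show ?thesis
      by (simp add: card_subfield)
  qed
  also have "\<dots> = (\<Sum>x\<in>UNIV. card {w \<in> subfield. Tr (c * x ^ 2) + 2 * Tr (c * x * w) = 0})"
    by (rule sum_card_swap) auto
  finally have "p * (p ^ k * ?E) =
      (\<Sum>x\<in>UNIV. p * card {w \<in> subfield. Tr (c * x ^ 2) + 2 * Tr (c * x * w) = 0})"
    by (simp add: sum_distrib_left)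
  also have "\<dots> = (\<Sum>x\<in>UNIV. if x \<in> subfield then p * p ^ k else p ^ k)"
  proof (rule sum.cong[OF refl])
    fix x
    have "{w \<in> subfield. Tr (c * x ^ 2) + 2 * Tr (c * x * w) = 0} = subfield" if "x \<in> subfield"
      using that by (auto simp: iso mult power2_eq_square mult.assoc)
    then show "p * card {w \<in> subfield. Tr (c * x ^ 2) + 2 * Tr (c * x * w) = 0} =
        (if x \<in> subfield then p * p ^ k else p ^ k)"
      by (cases "x \<in> subfield") (simp_all only: fibre card_subfield if_True if_False simp_thms)
  qed
  also have "\<dots> = p ^ k * (p * p ^ k) + (p ^ m - p ^ k) * p ^ k"
    using card_subfield card_field
    by (subst sum.If_cases) (simp_all add: Compl_eq_Diff_UNIV card_Diff_subset)
  finally have "p ^ k * (p * ?E) = p ^ k * (p * p ^ k + (p ^ m - p ^ k))"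
    by (simp add: algebra_simps)
  then have "p * ?E = p ^ (k + 1) + (p ^ m - p ^ k)"
    using p_ge_3 by simp
  moreover have "p ^ k \<le> p ^ m"
    using p_ge_3 m_eq by (intro power_increasing) auto
  ultimately have "int (p * ?E) = int (p ^ (k + 1)) + (int (p ^ m) - int (p ^ k))"
    by (simp only: of_nat_add of_nat_diff)
  then show ?thesis
    by simp
qed

section \<open>The sign and the level sets in even degree\<close>

lemma half_order_even: "(p ^ m - 1) div 2 = (p ^ k - 1) * ((p ^ k + 1) div 2)"
proof -
  have "even (p ^ k + 1)"
    using odd_p by simp
  then obtain j where j: "p ^ k + 1 = 2 * j"
    by blast
  have "p ^ m = p ^ k * p ^ k"
    by (simp add: m_eq mult_2 power_add)
  then have "p ^ m - 1 = (p ^ k - 1) * (p ^ k + 1)"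
    by (simp add: algebra_simps diff_mult_distrib)
  then have "p ^ m - 1 = 2 * ((p ^ k - 1) * j)"
    by (simp only: j mult.left_commute)
  then show ?thesis
    unfolding j by simp
qed

text \<open>Both sides are \<open>- 1\<close> exactly when \<open>p mod 4 = 3\<close> and
  \<open>k\<close> is odd.\<close>

lemma even_sign_eq: "even_sign p m = (if even ((p ^ k + 1) div 2) then - 1 else 1)"
proof -
  have "p mod 4 = 1 \<or> p mod 4 = 3"
    using odd_p by presburger
  then show ?thesis
  proof
    assume p: "p mod 4 = 1"
    then have "p ^ k mod 4 = 1"
      using power_mod[of p 4 k] by simp
    moreover have "even ((p - 1) div 2)" "odd ((n + 1) div 2)" if "n mod 4 = 1" for n :: nat
      using p that by presburger+
    ultimately show ?thesis
      by (simp add: even_sign_def)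
  next
    assume p: "p mod 4 = 3"
    have pk: "p ^ i mod 4 = (if even i then 1 else 3)" for i
    proof (induction i)
      case (Suc i)
      have "p ^ Suc i mod 4 = (p mod 4) * (p ^ i mod 4) mod 4"
        by (simp add: mod_mult_eq)
      then show ?case
        by (simp add: Suc p)
    qed simp
    have "odd ((p - 1) div 2)"
      using p by presburger
    moreover have "even ((n + 1) div 2) \<longleftrightarrow> odd k" if "n mod 4 = (if even k then 1 else 3)" for n :: nat
      using that by (cases "even k"; simp; presburger)
    ultimately show ?thesis
      using pk[of k] m_eq by (simp add: even_sign_def uminus_power_if)
  qed
qed

text \<open>If \<open>c\<close> is a square, \<open>Tr (c * x ^ 2)\<close> is equivalent to the
  original form; otherwise the two zero counts add up to \<open>2 * p ^ (m - 1)\<close>, which flips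
  the deviation.\<close>

lemma qcount_even_0:
  "int (qcount 0) = int p ^ (m - 1) - even_sign p m * (int p - 1) * int p ^ ((m - 2) div 2)"
proof -
  obtain c where c: "c \<noteq> 0" "conj_field c = - c"
    using exists_antisymmetric by blast
  let ?E = "card {x. Tr (c * x ^ 2) = 0}"
  let ?M = "int p ^ (m - 1)" and ?h = "int p ^ ((m - 2) div 2)"
  have p1: "int p ^ k = int p * ?h" "int p ^ (k + 1) = int p * (int p * ?h)" "int p ^ m = int p * ?M"
    using k_pos by (cases k; simp add: m_eq)+
  have "int p * int ?E = int p * (?M + (int p - 1) * ?h)"
    unfolding card_antisymmetric_form[OF c] p1 by (simp add: algebra_simps)
  then have E: "int ?E = ?M + (int p - 1) * ?h"
    using p_ge_3 by simp
  have "conj_field c = c * c ^ (p ^ k - 1)"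
    using p_ge_3 by (simp add: power_eq_if[of _ "p ^ k"])
  then have "c ^ (p ^ k - 1) = - 1"
    using c by (metis mult_cancel_left mult_minus1_right)
  \<comment> \<open>Splitting off the factor \<open>p ^ k - 1\<close> from the exponent turns
    Euler's criterion for \<open>c\<close> into a parity.\<close>
  then have "c ^ ((p ^ m - 1) div 2) = (- 1) ^ ((p ^ k + 1) div 2)"
    unfolding half_order_even power_mult by simp
  moreover have "(- 1 :: 'a) \<noteq> 1"
    using two_neq_0 by (metis one_add_one add.right_inverse)
  ultimately have square_iff: "(\<exists>y. c = y ^ 2) \<longleftrightarrow> even ((p ^ k + 1) div 2)"
    unfolding euler_criterion_field[OF c(1)] by (cases "even ((p ^ k + 1) div 2)") simp_all
  show ?thesis
  proof (cases "\<exists>y. c = y ^ 2")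
    case True
    then obtain y where y: "c = y ^ 2"
      by blast
    then have "y \<noteq> 0"
      using c by auto
    then have "?E = qcount 0"
      unfolding qcount_def y
      by (intro bij_betw_same_card[of "\<lambda>x. y * x"] bij_betw_byWitness[where f' = "\<lambda>x. x / y"])
        (auto simp: power_mult_distrib power_divide)
    then show ?thesis
      using E True square_iff even_sign_eq by (simp add: algebra_simps)
  next
    case False
    have "qcount 0 + ?E = 2 * p ^ (m - 1)"
      using False by (intro qcount_nonsquare_multiple) auto
    then have "int (qcount 0) + int ?E = 2 * ?M"
      by (metis of_nat_add of_nat_mult of_nat_numeral of_nat_power)
    then show ?thesis
      using E False square_iff even_sign_eq by simp
  qed
qed

text \<open>The index is even, so the exponent in Euler's criterion is a multiple of
  \<open>p - 1\<close>.\<close>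

lemma P_square_even:
  assumes "t \<in> P"
  shows "\<exists>y. t = (y::'a) ^ 2"
proof (cases "t = 0")
  case False
  obtain j where j: "(\<Sum>i<m. p ^ i) = 2 * j"
    using parity_index m_eq by (metis dvd_triv_left dvdE)
  then have "(p ^ m - 1) div 2 = (p - 1) * j"
    using pred_p_times_index by (metis mult.left_commute nonzero_mult_div_cancel_left zero_neq_numeral)
  then have "t ^ ((p ^ m - 1) div 2) = 1"
    using P_power_minus_1[OF assms False] by (simp add: power_mult)
  then show ?thesis
    using euler_criterion_field[OF False] by blast
qed (auto intro: exI[of _ 0])

text \<open>All nonzero elements of \<open>P\<close> are squares in the field, so their counts agree
  and the total \<open>p ^ m\<close> determines them.\<close>

lemma qcount_even:
  assumes "t \<in> P" and "t \<noteq> 0"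
  shows "int (qcount t) = int p ^ (m - 1) + even_sign p m * int p ^ ((m - 2) div 2)"
proof -
  have const: "qcount s = qcount 1" if "s \<in> P - {0}" for s
    using P_square_even[of s] qcount_square that by auto
  have pm: "int p ^ m = int p * int p ^ (m - 1)"
    using m_pos by (cases m) auto
  have "int p ^ m = int (qcount 0) + (\<Sum>s\<in>P - {0}. int (qcount s))"
    unfolding sum_qcount_eq[symmetric] by (rule sum.remove) auto
  also have "(\<Sum>s\<in>P - {0}. int (qcount s)) = (\<Sum>s\<in>P - {0::'a}. int (qcount t))"
  proof (rule sum.cong[OF refl])
    fix s :: 'a
    assume "s \<in> P - {0}"
    then have "qcount s = qcount t"
      using const[of s] const[of t] assms by simp
    then show "int (qcount s) = int (qcount t)"
      by simp
  qed
  also have "\<dots> = (int p - 1) * int (qcount t)"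
    using p_ge_3 by (simp add: card_P of_nat_diff)
  finally have "(int p - 1) * int (qcount t) =
      (int p - 1) * (int p ^ (m - 1) + even_sign p m * int p ^ ((m - 2) div 2))"
    unfolding pm qcount_even_0 by (simp add: algebra_simps)
  then show ?thesis
    using p_ge_3 by simp
qed

end

section \<open>Weight distributions\<close>

context field_extension
begin

text \<open>Encoding is linear, so two pairs with the same codeword differ by a pair of weight
  zero.\<close>

lemma weight_count_code_eq_family:
  assumes "\<And>a b. b \<in> P \<Longrightarrow> hamming_weight (codeword p m ds a b) = 0 \<Longrightarrow> a = 0 \<and> b = (0::'a)"
  shows "weight_count (code p m ds) i = family_weight_count p m ds i"
proof -
  let ?S = "{(a, b). b \<in> P \<and> hamming_weight (codeword p m ds a b) = i}"
  have "inj_on (\<lambda>(a, b). codeword p m ds a b) ?S"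
  proof (rule inj_onI, clarify)
    fix a b a' b'
    assume b: "b \<in> P" "b' \<in> P" and eq: "codeword p m ds a b = codeword p m ds a' b'"
    have "Tr ((a - a') * d) + (b - b') = 0" if "d \<in> set ds" for d
    proof -
      have "Tr (a * d) + b = Tr (a' * d) + b'"
        using eq that by (simp add: codeword_def)
      then show ?thesis
        by (simp add: left_diff_distrib Tr_diff algebra_simps)
    qed
    then have "hamming_weight (codeword p m ds (a - a') (b - b')) = 0"
      by (simp add: hamming_weight_def codeword_def)
    then show "a = a' \<and> b = b'"
      using assms[of "b - b'" "a - a'"] b by auto
  qed
  moreover have "{c \<in> code p m ds. hamming_weight c = i} = (\<lambda>(a, b). codeword p m ds a b) ` ?S"
    by (auto simp: code_def)
  ultimately show ?thesis
    unfolding weight_count_def family_weight_count_def by (simp add: card_image)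
qed

text \<open>For nonzero \<open>a\<close>, the lower bound on \<open>v\<close> excludes weight zero
  when \<open>b = 0\<close>, the upper bound when \<open>b\<close> is nonzero. Together they give
  \<open>qcount 0 > 1\<close>, which covers \<open>a = 0\<close>.\<close>

lemma hamming_weight_codeword_pos:
  assumes ds: "distinct ds" "set ds = defining_set p m"
    and v: "\<And>t. t \<in> P \<Longrightarrow> int p * v t = int (qcount 0) - int (qcount t) + int p ^ (m - 1)"
    and pos: "\<And>t. t \<in> P \<Longrightarrow> v t > 0 \<and> v t < int (qcount 0) - 1"
    and "b \<in> P" and zero: "hamming_weight (codeword p m ds a b) = 0"
  shows "a = 0 \<and> b = (0::'a)"
proof (cases "a = 0")
  case True
  then show ?thesis
    using hamming_weight_codeword_0[OF ds, of b] zero pos[OF P_0] by (auto split: if_splits)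
next
  case False
  have "(int p - 1) * v (Tr (a ^ 2)) > 0"
    using pos[OF Tr_in_P] p_ge_3 by (intro mult_pos_pos) auto
  then show ?thesis
    using hamming_weight_codeword_eq[OF ds False \<open>b \<in> P\<close> v[OF Tr_in_P]] zero pos[OF Tr_in_P, of "a ^ 2"]
    by (auto split: if_splits)
qed

lemma has_weight_distribution_odd:
  assumes ds: "distinct (ds :: 'a list)" "set ds = defining_set p m"
    and m: "odd m" "m \<ge> 3"
  shows "has_weight_distribution (weight_count (code p m ds)) (odd_table (int p) m)"
    and "has_weight_distribution (family_weight_count p m ds) (odd_table (int p) m)"
proof -
  define X Y h where "X = int p ^ (m - 2)" and "Y = int p ^ ((m - 3) div 2)"
    and "h = int p ^ ((m - 1) div 2)"
  have "m - 1 = Suc (m - 2)" "(m - 1) div 2 = Suc ((m - 3) div 2)"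
    using m by (auto elim!: oddE)
  then have M: "int p ^ (m - 1) = int p * X" "int p ^ (m - Suc 0) = int p * X" and h: "h = int p * Y"
    by (simp_all add: X_def Y_def h_def)
  define A where "A = {t \<in> P - {0}. int (qcount t) = int p ^ (m - 1) + int p ^ ((m - 1) div 2)}"
  define B where "B = {t \<in> P - {0}. int (qcount t) = int p ^ (m - 1) - int p ^ ((m - 1) div 2)}"
  \<comment> \<open>Solution of \<open>p * v t = N 0 - N t + p ^ (m - 1)\<close>, where
    \<open>N 0 = p * X\<close> and \<open>N t\<close> is \<open>p * X + p * Y\<close> on
    \<open>A\<close>, \<open>p * X - p * Y\<close> on \<open>B\<close>.\<close>
  define v where "v t = (if t = 0 then X else if t \<in> A then X - Y else X + Y)" for t
  have q0: "int (qcount 0) = int p * X"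
    using qcount_odd_0[OF m(1)] M by simp
  have Y_pos: "Y \<ge> 1"
    using p_ge_3 by (simp add: Y_def)
  have AB: "P - {0} = A \<union> B" "A \<inter> B = {}"
    using qcount_odd[OF m(1)] p_ge_3 by (auto simp: A_def B_def)
  have qA: "t \<noteq> 0" "int (qcount t) = int p * X + h" if "t \<in> A" for t
    using that by (auto simp: A_def M h_def)
  have qB: "t \<noteq> 0" "t \<notin> A" "int (qcount t) = int p * X - h" if "t \<in> B" for t
    using that AB(2) by (auto simp: B_def M h_def)
  have v: "int p * v t = int (qcount 0) - int (qcount t) + int p ^ (m - 1)" if "t \<in> P" for t
  proof -
    have "t = 0 \<or> t \<in> A \<union> B"
      using that unfolding AB(1)[symmetric] by simp
    then consider "t = 0" | "t \<in> A" | "t \<in> B"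
      by blast
    then show ?thesis
    proof cases
      case 1
      then show ?thesis
        by (simp add: v_def M)
    next
      case 2
      then show ?thesis
        by (simp add: v_def q0 qA M h algebra_simps)
    next
      case 3
      then show ?thesis
        by (simp add: v_def q0 qB M h algebra_simps)
    qed
  qed
  \<comment> \<open>The gap between \<open>Y\<close> and \<open>X\<close> keeps all values of
    \<open>v\<close> strictly between \<open>0\<close> and the length
    \<open>qcount 0 - 1\<close>.\<close>
  have "int p ^ Suc ((m - 3) div 2) \<le> X"
    unfolding X_def using p_ge_3 m by (intro power_increasing) auto
  then have pY: "int p * Y \<le> X"
    by (simp add: Y_def)
  moreover have "3 * Y \<le> int p * Y"
    using p_ge_3 Y_pos by (intro mult_right_mono) auto
  ultimately have XY: "3 * Y \<le> X"
    by simp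
  have pX: "3 * X \<le> int p * X"
    using p_ge_3 by (intro mult_right_mono) (auto simp: X_def)
  have pos: "v t > 0 \<and> v t < int (qcount 0) - 1" for t
  proof -
    have "v t = X \<or> v t = X - Y \<or> v t = X + Y"
      by (simp add: v_def)
    then show ?thesis
      using Y_pos XY pX unfolding q0 by (elim disjE; linarith)
  qed
  define a where "a = (int p - 1) div 2"
  have "even (int p - 1)"
    using odd_p by simp
  then have a: "int p - 1 = 2 * a"
    by (simp add: a_def)
  have card: "int (card A) = a" "int (card B) = a"
    using card_qcount_odd[OF m(1)] a by (simp_all add: A_def B_def)
  have "int (family_weight_count p m ds i) = (\<Sum>(w, k) \<leftarrow> odd_table (int p) m. if w = int i then k else 0)" for i
  proof -
    \<comment> \<open>With an opaque indicator, the claim is an identity between linear combinations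
      of terms \<open>I w\<close>; coinciding weights need no case distinction.\<close>
    define I :: "int \<Rightarrow> int" where "I w = of_bool (w = int i)" for w
    have I: "(if w = int i then k else 0) = k * I w" for w k
      by (simp add: I_def)
    let ?g = "\<lambda>t. (int (qcount t) - of_bool (t = 0)) * (I ((int p - 1) * v t) +
        (int p - 1) * I (int (qcount 0) - 1 - v t))"
    have "int (family_weight_count p m ds i) =
        I 0 + (int p - 1) * I (int (qcount 0) - 1) + (\<Sum>t\<in>P. ?g t)"
      unfolding I_def by (rule family_weight_count_eq[OF ds v])
    also have "(\<Sum>t\<in>P. ?g t) = ?g 0 + (\<Sum>t\<in>P - {0}. ?g t)"
      by (rule sum.remove) auto
    also have "(\<Sum>t\<in>P - {0}. ?g t) = (\<Sum>t\<in>A. ?g t) + (\<Sum>t\<in>B. ?g t)"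
      by (subst AB(1), rule sum.union_disjoint) (use AB(2) in auto)
    also have "(\<Sum>t\<in>A. ?g t) = (\<Sum>t\<in>A. (int p * X + h) * (I ((int p - 1) * (X - Y)) +
        (int p - 1) * I (int (qcount 0) - 1 - (X - Y))))"
      by (rule sum.cong) (simp_all add: v_def qA)
    also have "(\<Sum>t\<in>B. ?g t) = (\<Sum>t\<in>B. (int p * X - h) * (I ((int p - 1) * (X + Y)) +
        (int p - 1) * I (int (qcount 0) - 1 - (X + Y))))"
      by (rule sum.cong) (simp_all add: v_def qB)
    finally have 1: "int (family_weight_count p m ds i) =
        I 0 + (int p - 1) * I (int p * X - 1) +
        ((int p * X - 1) * (I ((int p - 1) * X) + (int p - 1) * I (int p * X - 1 - X)) +
        (a * ((int p * X + h) * (I ((int p - 1) * (X - Y)) +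
          (int p - 1) * I (int p * X - 1 - (X - Y)))) +
         a * ((int p * X - h) * (I ((int p - 1) * (X + Y)) +
          (int p - 1) * I (int p * X - 1 - (X + Y))))))"
      by (simp add: sum_constant card q0 v_def del: of_nat_mult sum_mult_of_bool_eq)
    have "(int p - 1) ^ 2 div 2 = (int p - 1) * a"
      unfolding a by (simp add: power2_eq_square)
    moreover have "(int p - 1) * X - 1 = int p * X - 1 - X"
      "(int p - 1) * X + Y - 1 = int p * X - 1 - (X - Y)"
      "(int p - 1) * X - Y - 1 = int p * X - 1 - (X + Y)"
      by (simp_all add: algebra_simps)
    ultimately have 2: "odd_table (int p) m =
      [(0, 1), (int p * X - 1, int p - 1), ((int p - 1) * X, int p * X - 1),
       (int p * X - 1 - X, (int p - 1) * (int p * X - 1)),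
       ((int p - 1) * (X - Y), a * (int p * X + h)),
       (int p * X - 1 - (X - Y), (int p - 1) * a * (int p * X + h)),
       ((int p - 1) * (X + Y), a * (int p * X - h)),
       (int p * X - 1 - (X + Y), (int p - 1) * a * (int p * X - h))]"
      unfolding odd_table_def M X_def[symmetric] Y_def[symmetric] h_def[symmetric] a_def[symmetric]
      by simp
    show ?thesis
      unfolding 1 2 by (simp add: I) (simp add: algebra_simps)
  qed
  then show fam: "has_weight_distribution (family_weight_count p m ds) (odd_table (int p) m)"
    by (simp add: has_weight_distribution_def)
  have "weight_count (code p m ds) i = family_weight_count p m ds i" for i
    by (rule weight_count_code_eq_family) (rule hamming_weight_codeword_pos[OF ds v pos])
  then show "has_weight_distribution (weight_count (code p m ds)) (odd_table (int p) m)"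
    using fam by (simp add: has_weight_distribution_def)
qed

end

context even_field_extension
begin

lemma has_weight_distribution_even:
  assumes ds: "distinct (ds :: 'a list)" "set ds = defining_set p m"
  shows "\<not> (m = 2 \<and> p mod 4 = 1) \<Longrightarrow>
      has_weight_distribution (weight_count (code p m ds)) (even_table (int p) m (even_sign p m))"
    and "has_weight_distribution (family_weight_count p m ds) (even_table (int p) m (even_sign p m))"
proof -
  define X Y e where "X = int p ^ (m - 2)" and "Y = int p ^ ((m - 2) div 2)"
    and "e = even_sign p m"
  have "m - 1 = Suc (m - 2)"
    using m_eq k_pos by simp
  then have M: "int p ^ (m - 1) = int p * X" "int p ^ (m - Suc 0) = int p * X"
    by (simp_all add: X_def)
  define v where "v t = (if t = 0 then X else X - e * Y)" for t :: 'a
  have q0: "int (qcount 0) = int p * X - e * (int p - 1) * Y"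
    using qcount_even_0 by (simp add: M Y_def e_def)
  have q: "int (qcount t) = int p * X + e * Y" if "t \<in> P" "t \<noteq> 0" for t
    using qcount_even[OF that] by (simp add: M Y_def e_def)
  have v: "int p * v t = int (qcount 0) - int (qcount t) + int p ^ (m - 1)" if "t \<in> P" for t
    using q[OF that] by (cases "t = 0") (simp_all add: v_def q0 M algebra_simps)
  have "int (family_weight_count p m ds i) =
      (\<Sum>(w, k) \<leftarrow> even_table (int p) m (even_sign p m). if w = int i then k else 0)" for i
  proof -
    define I :: "int \<Rightarrow> int" where "I w = of_bool (w = int i)" for w
    have I: "(if w = int i then k else 0) = k * I w" for w k
      by (simp add: I_def)
    let ?g = "\<lambda>t. (int (qcount t) - of_bool (t = 0)) * (I ((int p - 1) * v t) +
        (int p - 1) * I (int (qcount 0) - 1 - v t))"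
    \<comment> \<open>\<open>n\<close> is the length of the code.\<close>
    define n where "n = int (qcount 0) - 1"
    have n: "n = int p * X - 1 - e * (int p - 1) * Y"
      by (simp add: n_def q0)
    have "int (family_weight_count p m ds i) =
        I 0 + (int p - 1) * I (int (qcount 0) - 1) + (\<Sum>t\<in>P. ?g t)"
      unfolding I_def by (rule family_weight_count_eq[OF ds v])
    also have "(\<Sum>t\<in>P. ?g t) = ?g 0 + (\<Sum>t\<in>P - {0}. ?g t)"
      by (rule sum.remove) auto
    also have "(\<Sum>t\<in>P - {0}. ?g t) = (\<Sum>t\<in>P - {0::'a}. (int p * X + e * Y) *
        (I ((int p - 1) * (X - e * Y)) + (int p - 1) * I (n - (X - e * Y))))"
      by (rule sum.cong) (auto simp: v_def q n_def)
    also have "\<dots> = (int p - 1) * ((int p * X + e * Y) *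
        (I ((int p - 1) * (X - e * Y)) + (int p - 1) * I (n - (X - e * Y))))"
      using p_ge_3 by (simp add: card_P of_nat_diff)
    also have "?g 0 = n * (I ((int p - 1) * X) + (int p - 1) * I (n - X))"
      by (simp add: v_def n_def)
    finally have 1: "int (family_weight_count p m ds i) =
        I 0 + (int p - 1) * I n + (n * (I ((int p - 1) * X) + (int p - 1) * I (n - X)) +
        (int p - 1) * ((int p * X + e * Y) *
          (I ((int p - 1) * (X - e * Y)) + (int p - 1) * I (n - (X - e * Y)))))"
      by (simp add: n_def)
    have "(int p - 1) * (X - e * Y) - 1 = n - X"
      "(int p - 1) * X - (int p - 2) * e * Y - 1 = n - (X - e * Y)"
      by (simp_all add: n algebra_simps)
    then have 2: "even_table (int p) m (even_sign p m) =
      [(0, 1), (n, int p - 1), ((int p - 1) * X, n), (n - X, (int p - 1) * n),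
       ((int p - 1) * (X - e * Y), (int p - 1) * (int p * X + e * Y)),
       (n - (X - e * Y), (int p - 1) ^ 2 * (int p * X + e * Y))]"
      unfolding even_table_def M X_def[symmetric] Y_def[symmetric] e_def[symmetric]
      by (simp add: n)
    show ?thesis
      unfolding 1 2 by (simp add: I) (simp add: algebra_simps power2_eq_square)
  qed
  then show fam: "has_weight_distribution (family_weight_count p m ds) (even_table (int p) m (even_sign p m))"
    by (simp add: has_weight_distribution_def)
  \<comment> \<open>In the case set aside here \<open>X = Y = e = 1\<close> and
    \<open>qcount 0 = 1\<close>: the defining set is empty and all pairs give the empty
    word.\<close>
  assume not2: "\<not> (m = 2 \<and> p mod 4 = 1)"
  have Y_pos: "Y \<ge> 1"
    using p_ge_3 by (simp add: Y_def)
  have "m - 2 = (m - 2) div 2 + (m - 2) div 2"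
    using m_eq by presburger
  then have X_eq: "X = Y * Y"
    unfolding X_def Y_def by (metis power_add)
  have XY: "1 \<le> X" "3 * X \<le> int p * X" "3 * Y \<le> int p * Y"
    using p_ge_3 Y_pos by (auto simp: X_def)
  have v_cases: "v t = X \<or> v t = X - e * Y" for t
    by (simp add: v_def)
  have pos: "v t > 0 \<and> v t < int (qcount 0) - 1" for t
  proof -
    consider "e = - 1" | "e = 1"
      using even_sign_eq by (cases "even ((p ^ k + 1) div 2)") (auto simp: e_def)
    then show ?thesis
    proof cases
      case 1
      have "int (qcount 0) = int p * X + int p * Y - Y"
        unfolding q0 1 by (simp add: algebra_simps)
      moreover have "v t = X \<or> v t = X + Y"
        using v_cases[of t] 1 by simp
      ultimately show ?thesis
        using Y_pos XY by (elim disjE; linarith)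
    next
      case 2
      \<comment> \<open>For \<open>m = 2\<close> only \<open>p mod 4 = 3\<close> is left, and then
        the sign is \<open>- 1\<close>. So \<open>m >= 4\<close> and \<open>Y >= p\<close>, on which
        the bounds below rest.\<close>
      have "m \<noteq> 2"
      proof
        assume "m = 2"
        then have "p mod 4 = 3"
          using not2 odd_p by presburger
        then have "odd ((p - 1) div 2)"
          by presburger
        then show False
          using 2 \<open>m = 2\<close> by (simp add: e_def even_sign_def)
      qed
      then have "int p ^ 1 \<le> Y"
        unfolding Y_def using p_ge_3 m_eq k_pos by (intro power_increasing) auto
      then have Y: "3 \<le> Y"
        using p_ge_3 by simp
      then have X: "3 * Y \<le> X"
        unfolding X_eq by (intro mult_right_mono) auto
      then have "3 * (X - Y) \<le> int p * (X - Y)"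
        using p_ge_3 Y by (intro mult_right_mono) auto
      then have "3 * X - 3 * Y \<le> int p * X - int p * Y"
        by (simp only: right_diff_distrib)
      moreover have "int (qcount 0) = int p * X - int p * Y + Y"
        unfolding q0 2 by (simp add: algebra_simps)
      moreover have "v t = X \<or> v t = X - Y"
        using v_cases[of t] 2 by simp
      ultimately show ?thesis
        using X Y by (elim disjE; linarith)
    qed
  qed
  have "weight_count (code p m ds) i = family_weight_count p m ds i" for i
    by (rule weight_count_code_eq_family) (rule hamming_weight_codeword_pos[OF ds v pos])
  then show "has_weight_distribution (weight_count (code p m ds)) (even_table (int p) m (even_sign p m))"
    using fam by (simp add: has_weight_distribution_def)
qed

end

theorem corollary5:
  fixes p m :: nat
    and ds :: "'a::finite_field list"
  assumes "prime p" and "odd p" and "m > 0"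
    and "CARD('a) = p ^ m"
    and "distinct ds" and "set ds = defining_set p m"
  shows "(odd m \<and> m \<ge> 3 \<longrightarrow>
            has_weight_distribution (weight_count (code p m ds)) (odd_table (int p) m) \<and>
            has_weight_distribution (family_weight_count p m ds) (odd_table (int p) m)) \<and>
         (even m \<and> m \<ge> 2 \<longrightarrow>
            (\<not> (m = 2 \<and> p mod 4 = 1) \<longrightarrow>
               has_weight_distribution (weight_count (code p m ds))
                 (even_table (int p) m (even_sign p m))) \<and>
            has_weight_distribution (family_weight_count p m ds)
              (even_table (int p) m (even_sign p m)))"
proof -
  interpret field_extension p m "TYPE('a)"
    using assms by unfold_locales
  have "(\<not> (m = 2 \<and> p mod 4 = 1) \<longrightarrow>
        has_weight_distribution (weight_count (code p m ds)) (even_table (int p) m (even_sign p m))) \<and>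
      has_weight_distribution (family_weight_count p m ds) (even_table (int p) m (even_sign p m))"
    if "even m"
  proof -
    interpret even_field_extension p m "TYPE('a)" "m div 2"
      using that by unfold_locales simp
    show ?thesis
      using has_weight_distribution_even[OF assms(5,6)] by blast
  qed
  then show ?thesis
    using has_weight_distribution_odd[OF assms(5,6)] by blast
qed

end
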